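(* Let $\mathbb{D}_1=\{q\in\mathbb{C}:|q|<1\}$, for $(q,z)\in\mathbb{D}_1\times\mathbb{C}$ let $\theta(q,z):=\sum_{j=0}^{\infty}q^{j(j+1)/2}z^j$, and let $S:=\{(q,z)\in\mathbb{D}_1\times\mathbb{C} : \theta(q,z)=0\}$. Then $S$ is a connected analytic subset of $\mathbb{D}_1\times\mathbb{C}$. Moreover, $S$ is smooth at every point $(q^{\flat},z^{\flat})\in S$ such that $z^{\flat}$ is a simple or double zero of the entire function $\theta(q^{\flat},\cdot)$.
   Context: The function $\theta$ is the partial theta function; for each fixed $q\in\mathbb{D}_1$, $\theta(q,\cdot)$ is an entire function of $z$ (with $\theta(0,z)\equiv 1$). "Smooth at a point" means that in a neighbourhood of the point $S$ is a complex-analytic submanifold (of complex dimension $1$) of $\mathbb{D}_1\times\mathbb{C}$. A simple (double) zero is a zero of multiplicity exactly $1$ (exactly $2$). *)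

theory Defs
  imports "HOL-Complex_Analysis.Complex_Analysis"
begin

definition partial_theta :: "complex \<Rightarrow> complex \<Rightarrow> complex" where
  "partial_theta q z = (\<Sum>j. q ^ (j * (j + 1) div 2) * z ^ j)"

definition theta_domain :: "(complex \<times> complex) set" where
  "theta_domain = ball 0 1 \<times> UNIV"

definition theta_zeros :: "(complex \<times> complex) set" where
  "theta_zeros = {(q, z) \<in> theta_domain. partial_theta q z = 0}"

(* Holomorphy in two complex variables on an open set: the Frechet derivative exists at every
   point and is complex-linear. *)
definition holomorphic2_on :: "(complex \<times> complex \<Rightarrow> complex) \<Rightarrow> (complex \<times> complex) set \<Rightarrow> bool" where
  "holomorphic2_on f U \<longleftrightarrow>
     (\<forall>p\<in>U. \<exists>a b. (f has_derivative (\<lambda>(h, k). a * h + b * k)) (at p))"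

(* The local description is required at every point of U, not only at points of A; in particular
   A is relatively closed in U. *)
definition analytic_subset :: "(complex \<times> complex) set \<Rightarrow> (complex \<times> complex) set \<Rightarrow> bool" where
  "analytic_subset A U \<longleftrightarrow> A \<subseteq> U \<and>
     (\<forall>p\<in>U. \<exists>V F. open V \<and> p \<in> V \<and> V \<subseteq> U \<and> finite F \<and>
        (\<forall>f\<in>F. holomorphic2_on f V) \<and> A \<inter> V = {x \<in> V. \<forall>f\<in>F. f x = 0})"

definition biholomorphism2 ::
  "(complex \<times> complex) set \<Rightarrow> (complex \<times> complex) set \<Rightarrow>
   (complex \<times> complex \<Rightarrow> complex \<times> complex) \<Rightarrow> (complex \<times> complex \<Rightarrow> complex \<times> complex) \<Rightarrow> bool" where
  "biholomorphism2 V W \<phi> \<psi> \<longleftrightarrow> open V \<and> open W \<and> homeomorphism V W \<phi> \<psi> \<and>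
     holomorphic2_on (fst \<circ> \<phi>) V \<and> holomorphic2_on (snd \<circ> \<phi>) V \<and>
     holomorphic2_on (fst \<circ> \<psi>) W \<and> holomorphic2_on (snd \<circ> \<psi>) W"

(* Complex-analytic submanifold of complex dimension 1 of the open set U: near each of its points
   it is straightened to the first coordinate axis by a biholomorphic chart of U. *)
definition analytic_curve_submanifold ::
  "(complex \<times> complex) set \<Rightarrow> (complex \<times> complex) set \<Rightarrow> bool" where
  "analytic_curve_submanifold M U \<longleftrightarrow> M \<subseteq> U \<and>
     (\<forall>p\<in>M. \<exists>V W \<phi> \<psi>. p \<in> V \<and> V \<subseteq> U \<and> biholomorphism2 V W \<phi> \<psi> \<and>
        \<phi> ` (M \<inter> V) = {w \<in> W. snd w = 0})"

definition smooth_at ::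
  "(complex \<times> complex) set \<Rightarrow> (complex \<times> complex) set \<Rightarrow> complex \<times> complex \<Rightarrow> bool" where
  "smooth_at A U p \<longleftrightarrow>
     (\<exists>N. open N \<and> p \<in> N \<and> N \<subseteq> U \<and> analytic_curve_submanifold (A \<inter> N) U)"

end

(*
  Two facts drive the proof.  First, theta satisfies the heat-type equation
  2 q theta_q = z^2 theta_zz + 2 z theta_z, so at a simple or double zero (where q and z are nonzero)
  the gradient of theta does not vanish and the inverse function theorem straightens S.

  Second, for 0 < |q| < 1/100 the set S splits into the graphs ("branches") of functions
  z_k(q) ~ -q^(-k), k = 1, 2, ....  Let S be the union of two disjoint relatively closed parts A and B.
  A nonempty part A contains a whole branch: otherwise minimise |z| |q|^k over A with |q| <= rho, for
  large k; the minimum is interior, and Hurwitz' theorem for q |-> theta(q, c q^(-k)) forces the curve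
  z = c q^(-k) into A, which reaches small q.  It remains to put all branches on the same side.  For real
  q the zeros z_k are real, and certain pairs of neighbouring real zeros are confined to an interval
  whose end points are never zeros while all its zeros disappear as |q| -> 1:
    q > 0, z = -q^(-s):       {z_(2k-1), z_(2k)},
    q < 0, z = -|q|^(-s):     {z_(4k-2), z_(4k)},
    q < 0, z = |q|^(-s):      {z_(4k-1), z_(4k+1)}.
  By Janiszewski's theorem in the (q, s) rectangle, the two members of a pair cannot lie on different
  sides.  These pairs chain all branches together: 1-2-4-3-5-6-8-7-9-....
*)
theory Submission
  imports Defs
begin

section \<open>The series and its derivatives\<close>

text \<open>The obstacle is that zeros collide as |q| grows, at places that are not located, so
  branches cannot be followed beyond small q. The proof only compares: minimality of |z| |q|^k
  excludes zeros on the shrunken curves z = x c q^(-k), x < 1, which is the hypothesis of Hurwitz'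
  theorem; and joining two branches uses only signs of theta on the boundary of a rectangle. The
  signs come from two identities. theta(q, -q^(-n)) = q^n theta(q, -q^n) moves the end points into
  the unit disc. Splitting the series into even and odd powers writes theta(-p, x) through two theta
  functions with base p^4 at negative arguments, so negative q is largely reduced to theta(p, -y)
  with 0 < p < 1. That function is controlled by iterating the functional equation two steps at a
  time, which keeps the coefficients nonnegative. Positive q alone joins only disjoint pairs;
  negative q, with real zeros of both signs, supplies the links between them.\<close>

definition tri :: "nat \<Rightarrow> nat" where
  "tri j = j * (j + 1) div 2"

lemma two_tri: "2 * tri j = j * (j + 1)"
  by (simp add: tri_def)

lemma tri_0 [simp]: "tri 0 = 0"
  by (simp add: tri_def)

lemma tri_Suc: "tri (Suc j) = tri j + Suc j"
  using two_tri[of j] two_tri[of "Suc j"] by (simp add: algebra_simps)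

lemma tri_add: "tri (a + b) = tri a + tri b + a * b"
  by (induction b) (simp_all add: tri_Suc)

lemma tri_ge: "j \<le> tri j"
  by (induction j) (simp_all add: tri_Suc)

lemma partial_theta_tri: "partial_theta q z = (\<Sum>j. q ^ tri j * z ^ j)"
  by (simp add: partial_theta_def tri_def)

text \<open>The quadratic weight dominates the factors \<open>n\<close> and \<open>tri n\<close>
  that termwise differentiation brings down. The ratio of consecutive terms is at most 4 R r^(n+1),
  which tends to 0.\<close>

lemma summable_theta_weighted:
  fixes r R :: real
  assumes "0 < r" "r < 1" "0 < R"
  shows "summable (\<lambda>n. (real n + 1)^2 * r ^ tri n * R ^ n)"
proof -
  have "(\<lambda>n. 4 * R * r ^ Suc n) \<longlonglongrightarrow> 4 * R * 0"
    using assms by (intro tendsto_intros LIMSEQ_Suc[OF LIMSEQ_power_zero]) auto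
  then have "eventually (\<lambda>n. 4 * R * r ^ Suc n < 1/2) sequentially"
    by (rule order_tendstoD) simp
  then obtain N where N: "\<And>n. n \<ge> N \<Longrightarrow> 4 * R * r ^ Suc n < 1/2"
    by (auto simp: eventually_sequentially)
  show ?thesis
  proof (rule summable_ratio_test[where c = "1/2" and N = N])
    fix n assume "n \<ge> N"
    have "(real n + 2)^2 \<le> 4 * (real n + 1)^2"
      by (simp add: power2_eq_square algebra_simps)
    then have "(real n + 2)^2 * (r ^ tri n * r ^ Suc n * (R ^ n * R)) \<le>
        4 * (real n + 1)^2 * (r ^ tri n * r ^ Suc n * (R ^ n * R))"
      using assms by (intro mult_right_mono) auto
    also have "\<dots> = (4 * R * r ^ Suc n) * ((real n + 1)^2 * r ^ tri n * R ^ n)"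
      by (simp only: mult_ac)
    also have "\<dots> \<le> 1/2 * ((real n + 1)^2 * r ^ tri n * R ^ n)"
      using assms N[OF \<open>n \<ge> N\<close>] by (intro mult_right_mono) auto
    finally show "norm ((real (Suc n) + 1)^2 * r ^ tri (Suc n) * R ^ Suc n)
        \<le> 1/2 * norm ((real n + 1)^2 * r ^ tri n * R ^ n)"
      using assms by (simp add: tri_Suc power_add mult_ac add.commute)
  qed simp
qed

lemma summable_theta_majorant:
  fixes r R :: real
  assumes "0 \<le> r" "r < 1" "0 \<le> R"
  shows "summable (\<lambda>n. r ^ tri n * R ^ n)"
proof (rule summable_comparison_test')
  show "summable (\<lambda>n. (real n + 1)^2 * ((r+1)/2) ^ tri n * (R+1) ^ n)"
    using assms by (intro summable_theta_weighted) auto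
  fix n
  have "1 * r ^ tri n * R ^ n \<le> (real n + 1)^2 * ((r+1)/2) ^ tri n * (R+1) ^ n"
    using assms by (intro mult_mono power_mono) auto
  then show "norm (r ^ tri n * R ^ n) \<le> (real n + 1)^2 * ((r+1)/2) ^ tri n * (R+1) ^ n"
    using assms by simp
qed

lemma summable_norm_theta:
  fixes q z :: "'a::real_normed_field"
  assumes "norm q < 1"
  shows "summable (\<lambda>n. norm (q ^ tri n * z ^ n))"
  using summable_theta_majorant[of "norm q" "norm z"] assms
  by (simp add: norm_mult norm_power)

lemma summable_theta:
  fixes q z :: "'a::{real_normed_field,banach}"
  assumes "norm q < 1"
  shows "summable (\<lambda>n. q ^ tri n * z ^ n)"
  by (rule summable_norm_cancel[OF summable_norm_theta[OF assms]])

text \<open>The tail is a theta series again because tri (n + k) = tri n + tri k + n k: the mixed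
  term turns z into q^k z.\<close>

lemma partial_theta_split:
  assumes "norm q < 1"
  shows "partial_theta q z =
    (\<Sum>j<k. q ^ tri j * z ^ j) + z ^ k * q ^ tri k * partial_theta q (q ^ k * z)"
proof -
  have "partial_theta q z = (\<Sum>n. q ^ tri (n + k) * z ^ (n + k)) + (\<Sum>j<k. q ^ tri j * z ^ j)"
    unfolding partial_theta_tri by (rule suminf_split_initial_segment[OF summable_theta[OF assms]])
  also have "(\<lambda>n. q ^ tri (n + k) * z ^ (n + k)) =
      (\<lambda>n. z ^ k * q ^ tri k * (q ^ tri n * (q ^ k * z) ^ n))"
    by (rule ext) (simp add: tri_add power_add power_mult_distrib mult_ac flip: power_mult)
  also have "(\<Sum>n. z ^ k * q ^ tri k * (q ^ tri n * (q ^ k * z) ^ n)) =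
      z ^ k * q ^ tri k * partial_theta q (q ^ k * z)"
    unfolding partial_theta_tri by (rule suminf_mult[OF summable_theta[OF assms]])
  finally show ?thesis by simp
qed

lemma partial_theta_rec:
  assumes "norm q < 1"
  shows "partial_theta q z = 1 + q * z * partial_theta q (q * z)"
  using partial_theta_split[OF assms, of z 1] by (simp add: tri_def mult_ac)

lemma partial_theta_q0 [simp]: "partial_theta 0 z = 1"
  using partial_theta_rec[of 0 z] by simp

lemma partial_theta_z0: "norm q < 1 \<Longrightarrow> partial_theta q 0 = 1"
  using partial_theta_rec[of q 0] by simp

text \<open>Since \<open>tri n\<close> is at least n, the terms after the first are dominated by the
  geometric series in |q z|.\<close>

lemma norm_partial_theta_minus_1_le:
  assumes "norm q < 1" "norm q * norm z < 1"
  shows "norm (partial_theta q z - 1) \<le> norm q * norm z / (1 - norm q * norm z)"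
proof -
  let ?x = "norm q * norm z"
  have s: "summable (\<lambda>n. norm (q ^ tri (Suc n) * z ^ Suc n))"
    using summable_norm_theta[OF assms(1), of z] by (subst summable_Suc_iff)
  have "partial_theta q z - 1 = (\<Sum>n. q ^ tri (Suc n) * z ^ Suc n)"
    using suminf_split_head[OF summable_theta[OF assms(1), of z]] by (simp add: partial_theta_tri)
  also have "norm \<dots> \<le> (\<Sum>n. norm (q ^ tri (Suc n) * z ^ Suc n))"
    by (rule summable_norm[OF s])
  also have "\<dots> \<le> (\<Sum>n. ?x * ?x ^ n)"
  proof (rule suminf_le[OF _ s])
    show "summable (\<lambda>n. ?x * ?x ^ n)"
      using assms by (intro summable_mult summable_geometric) auto
    fix n
    have "norm q ^ tri (Suc n) \<le> norm q ^ Suc n"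
      using assms by (intro power_decreasing tri_ge) auto
    then have "norm (q ^ tri (Suc n) * z ^ Suc n) \<le> norm q ^ Suc n * norm z ^ Suc n"
      unfolding norm_mult norm_power by (intro mult_right_mono) auto
    then show "norm (q ^ tri (Suc n) * z ^ Suc n) \<le> ?x * ?x ^ n"
      by (simp add: power_mult_distrib mult_ac)
  qed
  also have "\<dots> = ?x / (1 - ?x)"
    using assms by (subst suminf_mult) (auto simp: suminf_geometric intro!: summable_geometric)
  finally show ?thesis .
qed

lemma theta_zeros_iff: "(q, z) \<in> theta_zeros \<longleftrightarrow> norm q < 1 \<and> partial_theta q z = 0"
  by (auto simp: theta_zeros_def theta_domain_def)

text \<open>For |z| < 1/2 the geometric bound gives |theta - 1| < 1. The lower bound on |z| later
  bounds |z| |q|^k from below on a circle |q| = rho.\<close>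

lemma theta_zero_norm_ge:
  assumes "(q, z) \<in> theta_zeros"
  shows "1/2 \<le> norm z"
proof (rule ccontr)
  assume "\<not> 1/2 \<le> norm z"
  have q: "norm q < 1" and 0: "partial_theta q z = 0"
    using assms by (auto simp: theta_zeros_iff)
  have "norm q * norm z \<le> 1 * norm z"
    using q by (intro mult_right_mono) auto
  then have x: "norm q * norm z < 1/2"
    using \<open>\<not> 1/2 \<le> norm z\<close> by linarith
  have "1 \<le> norm q * norm z / (1 - norm q * norm z)"
    using norm_partial_theta_minus_1_le[of q z] q x 0 by simp
  then show False using x by (simp add: field_simps)
qed

section \<open>Termwise partial derivatives and joint differentiability\<close>

definition theta_dq :: "complex \<times> complex \<Rightarrow> complex" where
  "theta_dq x = (\<Sum>n. of_nat (tri n) * fst x ^ (tri n - 1) * snd x ^ n)"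

text \<open>In both series the truncated exponent differs from the true one only at n = 0, where the
  coefficient vanishes.\<close>

definition theta_dz :: "complex \<times> complex \<Rightarrow> complex" where
  "theta_dz x = (\<Sum>n. of_nat n * fst x ^ tri n * snd x ^ (n - 1))"

text \<open>Dividing by r pays for the exponent \<open>tri n - 1\<close>; the second bound has the
  same form so that one summable majorant serves both series.\<close>

lemma theta_terms_bound:
  fixes q z :: complex
  assumes r: "0 < r" "r < 1" "1 \<le> R" and q: "norm q \<le> r" and z: "norm z \<le> R"
  shows "norm (of_nat (tri n) * q ^ (tri n - 1) * z ^ n) \<le> ((real n + 1)^2 * r ^ tri n * R ^ n) / r"
    and "norm (of_nat n * q ^ tri n * z ^ (n - 1)) \<le> ((real n + 1)^2 * r ^ tri n * R ^ n) / r"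
proof -
  have t: "real (tri n) \<le> (real n + 1)^2"
  proof -
    have "2 * real (tri n) = real n * (real n + 1)"
      using two_tri[of n] by (metis of_nat_1 of_nat_add of_nat_mult of_nat_numeral)
    then show ?thesis by (simp add: power2_eq_square algebra_simps)
  qed
  have "norm (of_nat (tri n) * q ^ (tri n - 1) * z ^ n) = real (tri n) * norm q ^ (tri n - 1) * norm z ^ n"
    by (simp add: norm_mult norm_power)
  also have "\<dots> \<le> real (tri n) * (r ^ tri n / r) * R ^ n"
  proof (cases "tri n = 0")
    case False
    then have "r ^ tri n / r = r ^ (tri n - 1)"
      using r by (cases "tri n") auto
    then show ?thesis using r q z
      by (auto intro!: mult_mono power_mono)
  qed simp
  also have "\<dots> \<le> (real n + 1)^2 * (r ^ tri n / r) * R ^ n"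
    using r t by (intro mult_right_mono) auto
  finally show "norm (of_nat (tri n) * q ^ (tri n - 1) * z ^ n) \<le> ((real n + 1)^2 * r ^ tri n * R ^ n) / r"
    by simp
  have "norm (of_nat n * q ^ tri n * z ^ (n - 1)) = real n * norm q ^ tri n * norm z ^ (n - 1)"
    by (simp add: norm_mult norm_power)
  also have "\<dots> \<le> (real n + 1)^2 * r ^ tri n * R ^ n"
  proof (intro mult_mono power_mono)
    show "real n \<le> (real n + 1)^2" by (simp add: power2_eq_square algebra_simps)
    have "norm z ^ (n - 1) \<le> R ^ (n - 1)" using z by (intro power_mono) auto
    also have "\<dots> \<le> R ^ n" using r by (intro power_increasing) auto
    finally show "norm z ^ (n - 1) \<le> R ^ n" .
  qed (use r q in auto)
  also have "\<dots> \<le> ((real n + 1)^2 * r ^ tri n * R ^ n) / r"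
    using r by (simp add: field_simps mult_left_le)
  finally show "norm (of_nat n * q ^ tri n * z ^ (n - 1)) \<le> ((real n + 1)^2 * r ^ tri n * R ^ n) / r" .
qed

text \<open>Differentiability in both variables jointly: the termwise Frechet derivatives converge
  uniformly on a polydisc, relative to the norm of the direction. The polydisc is convex, as
  \<open>has_derivative_series\<close> demands.\<close>

lemma theta_local:
  assumes r: "0 < r" "r < 1" "1 \<le> R"
  shows "uniform_limit (ball 0 r \<times> ball 0 R)
      (\<lambda>N x. \<Sum>n<N. of_nat (tri n) * fst x ^ (tri n - 1) * snd x ^ n) theta_dq sequentially"
    and "uniform_limit (ball 0 r \<times> ball 0 R)
      (\<lambda>N x. \<Sum>n<N. of_nat n * fst x ^ tri n * snd x ^ (n - 1)) theta_dz sequentially"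
    and "x \<in> ball 0 r \<times> ball 0 R \<Longrightarrow>
      ((\<lambda>(q, z). partial_theta q z) has_derivative (\<lambda>(h, k). theta_dq x * h + theta_dz x * k)) (at x)"
proof -
  let ?S = "ball 0 r \<times> ball 0 R :: (complex \<times> complex) set"
  have sm: "summable (\<lambda>n. ((real n + 1)^2 * r ^ tri n * R ^ n) / r)"
    using r by (intro summable_divide summable_theta_weighted) auto
  show u1: "uniform_limit ?S
      (\<lambda>N x. \<Sum>n<N. of_nat (tri n) * fst x ^ (tri n - 1) * snd x ^ n) theta_dq sequentially"
    unfolding theta_dq_def
    by (rule Weierstrass_m_test[OF _ sm], rule theta_terms_bound(1)) (use r in auto)
  show u2: "uniform_limit ?S
      (\<lambda>N x. \<Sum>n<N. of_nat n * fst x ^ tri n * snd x ^ (n - 1)) theta_dz sequentially"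
    unfolding theta_dz_def
    by (rule Weierstrass_m_test[OF _ sm], rule theta_terms_bound(2)) (use r in auto)
  assume x: "x \<in> ?S"
  define f where "f n x = fst x ^ tri n * snd x ^ n" for n and x :: "complex \<times> complex"
  define f' where "f' n x h = of_nat (tri n) * fst x ^ (tri n - 1) * snd x ^ n * fst h
     + of_nat n * fst x ^ tri n * snd x ^ (n - 1) * snd h" for n and x h :: "complex \<times> complex"
  define g' where "g' x h = theta_dq x * fst h + theta_dz x * snd h" for x h :: "complex \<times> complex"
  have "\<exists>g. \<forall>x\<in>?S. (\<lambda>n. f n x) sums (g x) \<and> (g has_derivative g' x) (at x within ?S)"
  proof (rule has_derivative_series)
    show "convex ?S" by (intro convex_Times convex_ball)
    show "(f n has_derivative f' n x) (at x within ?S)" for n x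
      unfolding f_def f'_def by (auto intro!: derivative_eq_intros simp: fun_eq_iff algebra_simps)
    show "x \<in> ?S" by fact
    show "(\<lambda>n. f n x) sums partial_theta (fst x) (snd x)"
      unfolding f_def partial_theta_tri using x r by (intro summable_sums summable_theta) auto
    fix e :: real assume "e > 0"
    have "\<forall>\<^sub>F N in sequentially. \<forall>x\<in>?S.
      dist (\<Sum>n<N. of_nat (tri n) * fst x ^ (tri n - 1) * snd x ^ n) (theta_dq x) < e/2"
      using u1 \<open>e > 0\<close> by (intro uniform_limitD) auto
    moreover have "\<forall>\<^sub>F N in sequentially. \<forall>x\<in>?S.
      dist (\<Sum>n<N. of_nat n * fst x ^ tri n * snd x ^ (n - 1)) (theta_dz x) < e/2"
      using u2 \<open>e > 0\<close> by (intro uniform_limitD) auto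
    ultimately show "\<forall>\<^sub>F N in sequentially. \<forall>x\<in>?S. \<forall>h. norm ((\<Sum>i<N. f' i x h) - g' x h) \<le> e * norm h"
    proof eventually_elim
      case (elim N)
      show ?case
      proof safe
        fix q z h k assume *: "q \<in> ball (0::complex) r" "z \<in> ball (0::complex) R"
        let ?x = "(q, z)"
        define a where "a = (\<Sum>n<N. of_nat (tri n) * fst ?x ^ (tri n - 1) * snd ?x ^ n) - theta_dq ?x"
        define b where "b = (\<Sum>n<N. of_nat n * fst ?x ^ tri n * snd ?x ^ (n - 1)) - theta_dz ?x"
        have ab: "norm a < e/2" "norm b < e/2"
          using elim * by (auto simp: a_def b_def dist_norm)
        have "(\<Sum>i<N. f' i ?x (h,k)) - g' ?x (h,k) = a * h + b * k"
          by (simp add: f'_def g'_def a_def b_def sum.distrib sum_distrib_right sum_distrib_left algebra_simps)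
        also have "norm \<dots> \<le> norm a * norm h + norm b * norm k"
          by (metis norm_mult norm_triangle_ineq)
        also have "\<dots> \<le> e/2 * norm (h,k) + e/2 * norm (h,k)"
          using ab norm_fst_le[of h k] norm_snd_le[of k h] \<open>e > 0\<close> by (intro add_mono mult_mono) auto
        finally show "norm ((\<Sum>i<N. f' i (q,z) (h,k)) - g' (q,z) (h,k)) \<le> e * norm (h,k)" by simp
      qed
    qed
  qed
  then obtain g where g: "\<And>x. x \<in> ?S \<Longrightarrow> (\<lambda>n. f n x) sums g x"
    "\<And>x. x \<in> ?S \<Longrightarrow> (g has_derivative g' x) (at x within ?S)" by blast
  have op: "open ?S" by (intro open_Times open_ball)
  have gx: "(g has_derivative g' x) (at x)"
    using g(2)[OF x] at_within_open[OF x op] by simp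
  have "((\<lambda>(q, z). partial_theta q z) has_derivative g' x) (at x)"
  proof (rule has_derivative_transform_within_open[OF gx op x])
    fix y assume "y \<in> ?S"
    from g(1)[OF this] show "g y = (case y of (q, z) \<Rightarrow> partial_theta q z)"
      by (cases y) (auto simp: f_def partial_theta_tri sums_iff)
  qed
  then show "((\<lambda>(q, z). partial_theta q z) has_derivative (\<lambda>(h, k). theta_dq x * h + theta_dz x * k)) (at x)"
    by (rule has_derivative_eq_rhs) (simp add: g'_def fun_eq_iff)
qed

lemma theta_domain_local:
  assumes "x \<in> theta_domain"
  obtains r R where "0 < r" "r < 1" "1 \<le> R" "x \<in> ball 0 r \<times> ball 0 R"
proof -
  obtain q z where x: "x = (q, z)" by (cases x)
  have "norm q < 1" using assms by (auto simp: x theta_domain_def)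
  then show ?thesis
    using that[of "(norm q + 1)/2" "norm z + 1"] by (auto simp: x add_nonneg_pos)
qed

lemma open_theta_domain: "open theta_domain"
  unfolding theta_domain_def by (intro open_Times open_ball open_UNIV)

lemma has_derivative_theta:
  assumes "x \<in> theta_domain"
  shows "((\<lambda>(q, z). partial_theta q z) has_derivative (\<lambda>(h, k). theta_dq x * h + theta_dz x * k)) (at x)"
  using theta_domain_local[OF assms] theta_local(3) by metis

lemma continuous_on_theta_dq: "continuous_on theta_domain theta_dq"
  and continuous_on_theta_dz: "continuous_on theta_domain theta_dz"
proof -
  have "continuous (at x) theta_dq \<and> continuous (at x) theta_dz" if x: "x \<in> theta_domain" for x
  proof -
    obtain r R where rR: "0 < r" "r < 1" "1 \<le> R" "x \<in> ball 0 r \<times> ball 0 R"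
      using theta_domain_local[OF x] .
    have op: "open (ball 0 r \<times> ball 0 R :: (complex \<times> complex) set)"
      by (intro open_Times open_ball)
    have "continuous_on (ball 0 r \<times> ball 0 R) theta_dq"
      by (rule uniform_limit_theorem[OF _ theta_local(1)[OF rR(1-3)]])
         (auto intro!: always_eventually continuous_intros)
    moreover have "continuous_on (ball 0 r \<times> ball 0 R) theta_dz"
      by (rule uniform_limit_theorem[OF _ theta_local(2)[OF rR(1-3)]])
         (auto intro!: always_eventually continuous_intros)
    ultimately show ?thesis
      using op rR(4) continuous_on_eq_continuous_at by blast
  qed
  then show "continuous_on theta_domain theta_dq" "continuous_on theta_domain theta_dz"
    by (auto intro: continuous_at_imp_continuous_on)
qed

lemma continuous_on_theta: "continuous_on theta_domain (\<lambda>(q, z). partial_theta q z)"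
  by (auto intro!: continuous_at_imp_continuous_on has_derivative_continuous[OF has_derivative_theta])

lemma continuous_on_theta_comp:
  assumes "continuous_on S f" "continuous_on S g" "\<And>x. x \<in> S \<Longrightarrow> norm (f x) < 1"
  shows "continuous_on S (\<lambda>x. partial_theta (f x) (g x))"
proof -
  have "continuous_on S ((\<lambda>(q, z). partial_theta q z) \<circ> (\<lambda>x. (f x, g x)))"
    using assms by (intro continuous_on_compose continuous_intros continuous_on_subset[OF continuous_on_theta])
      (auto simp: theta_domain_def)
  then show ?thesis by (simp add: o_def)
qed

lemma has_field_derivative_theta_comp:
  assumes f: "(f has_field_derivative f') (at x)" and g: "(g has_field_derivative g') (at x)"
    and "norm (f x) < 1"
  shows "((\<lambda>x. partial_theta (f x) (g x)) has_field_derivative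
    theta_dq (f x, g x) * f' + theta_dz (f x, g x) * g') (at x)"
proof -
  have 1: "((\<lambda>x. (f x, g x)) has_derivative (\<lambda>h. (f' * h, g' * h))) (at x)"
    using f g by (intro has_derivative_Pair) (auto simp: has_field_derivative_def)
  have 2: "((\<lambda>(q, z). partial_theta q z) has_derivative
      (\<lambda>(h, k). theta_dq (f x, g x) * h + theta_dz (f x, g x) * k)) (at (f x, g x))"
    using assms(3) by (intro has_derivative_theta) (auto simp: theta_domain_def)
  have "((\<lambda>x. partial_theta (f x) (g x)) has_derivative
      (\<lambda>h. theta_dq (f x, g x) * (f' * h) + theta_dz (f x, g x) * (g' * h))) (at x)"
    using diff_chain_at[OF 1 2] by (simp add: o_def)
  then show ?thesis
    unfolding has_field_derivative_def
    by (rule has_derivative_eq_rhs) (simp add: fun_eq_iff algebra_simps)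
qed

lemma holomorphic_on_theta_comp:
  assumes "f holomorphic_on S" "g holomorphic_on S" "open S" "\<And>x. x \<in> S \<Longrightarrow> norm (f x) < 1"
  shows "(\<lambda>x. partial_theta (f x) (g x)) holomorphic_on S"
proof (rule holomorphic_onI)
  fix x assume x: "x \<in> S"
  have "(f has_field_derivative deriv f x) (at x)" "(g has_field_derivative deriv g x) (at x)"
    using assms x by (auto intro: holomorphic_derivI)
  from has_field_derivative_theta_comp[OF this assms(4)[OF x]]
  show "(\<lambda>x. partial_theta (f x) (g x)) field_differentiable at x within S"
    using field_differentiable_at_within field_differentiable_def by blast
qed

section \<open>Regular points of the zero set\<close>

text \<open>\<open>f\<close> becomes the second coordinate of the chart. The inverse function
  theorem is a real one, so complex linearity of the inverse derivative is read off from the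
  cofactor formula for 2 x 2 matrices.\<close>

lemma regular_point_chart:
  fixes f a b :: "complex \<times> complex \<Rightarrow> complex"
  assumes U: "open U" and der: "\<And>x. x \<in> U \<Longrightarrow> (f has_derivative (\<lambda>(h, k). a x * h + b x * k)) (at x)"
    and conta: "continuous_on U a" and contb: "continuous_on U b"
    and x0: "x0 \<in> U" and reg: "a x0 \<noteq> 0 \<or> b x0 \<noteq> 0"
  obtains V W \<phi> \<psi> where "x0 \<in> V" "V \<subseteq> U" "biholomorphism2 V W \<phi> \<psi>" "\<And>x. snd (\<phi> x) = f x"
proof -
  \<comment> \<open>With these coefficients the Jacobian determinant at \<open>x0\<close> is |a|^2 +
    |b|^2, so one formula covers both alternatives of \<open>reg\<close>.\<close>
  define \<alpha> where "\<alpha> = cnj (b x0)"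
  define \<beta> where "\<beta> = - cnj (a x0)"
  have D0: "\<alpha> * b x0 - \<beta> * a x0 \<noteq> 0"
  proof -
    have "\<alpha> * b x0 - \<beta> * a x0 = of_real ((norm (b x0))\<^sup>2 + (norm (a x0))\<^sup>2)"
      unfolding \<alpha>_def \<beta>_def of_real_add complex_norm_square by (simp add: mult.commute)
    also have "\<dots> \<noteq> 0"
      using reg by (simp only: of_real_eq_0_iff) (auto simp: sum_power2_eq_zero_iff)
    finally show ?thesis .
  qed
  define \<phi> where "\<phi> x = (\<alpha> * fst x + \<beta> * snd x, f x)" for x
  define L where "L x v = (\<alpha> * fst v + \<beta> * snd v, a x * fst v + b x * snd v)" for x v :: "complex \<times> complex"
  have blL: "bounded_linear (L x)" for x
    unfolding L_def
    by (intro bounded_linear_Pair bounded_linear_add bounded_linear_const_mult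
        bounded_linear_fst bounded_linear_snd)
  define \<phi>' where "\<phi>' x = Blinfun (L x)" for x
  have \<phi>'_apply [simp]: "blinfun_apply (\<phi>' x) = L x" for x
    unfolding \<phi>'_def by (rule bounded_linear_Blinfun_apply[OF blL])
  have der\<phi>: "(\<phi> has_derivative blinfun_apply (\<phi>' x)) (at x)" if "x \<in> U" for x
  proof -
    have "(\<phi> has_derivative (\<lambda>v. (\<alpha> * fst v + \<beta> * snd v, (\<lambda>(h, k). a x * h + b x * k) v))) (at x)"
      unfolding \<phi>_def by (intro derivative_intros der that)
    then show ?thesis
      by (rule has_derivative_eq_rhs) (auto simp: L_def fun_eq_iff)
  qed
  have cont: "continuous_on U \<phi>'"
    by (rule continuous_on_blinfun_componentwise)
       (auto simp: L_def intro!: continuous_intros conta contb)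
  define M where "M v = ((b x0 * fst v - \<beta> * snd v) / (\<alpha> * b x0 - \<beta> * a x0),
      (\<alpha> * snd v - a x0 * fst v) / (\<alpha> * b x0 - \<beta> * a x0))" for v
  have blM: "bounded_linear M"
    unfolding M_def
    by (intro bounded_linear_Pair bounded_linear_divide[THEN bounded_linear_compose] bounded_linear_sub
        bounded_linear_const_mult bounded_linear_fst bounded_linear_snd)
  have M_L: "M (L x0 v) = v" for v
  proof -
    have "b x0 * (\<alpha> * fst v + \<beta> * snd v) - \<beta> * (a x0 * fst v + b x0 * snd v) = (\<alpha> * b x0 - \<beta> * a x0) * fst v"
      "\<alpha> * (a x0 * fst v + b x0 * snd v) - a x0 * (\<alpha> * fst v + \<beta> * snd v) = (\<alpha> * b x0 - \<beta> * a x0) * snd v"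
      by (simp_all add: algebra_simps)
    then show ?thesis
      unfolding M_def L_def using D0 by (simp add: prod_eq_iff)
  qed
  have inv0: "Blinfun M o\<^sub>L \<phi>' x0 = id_blinfun"
    by (rule blinfun_eqI) (simp add: bounded_linear_Blinfun_apply[OF blM] M_L)
  obtain V W \<psi> \<psi>' where *: "open V" "V \<subseteq> U" "x0 \<in> V" "open W" "\<phi> x0 \<in> W" "homeomorphism V W \<phi> \<psi>"
    "\<And>y. y \<in> W \<Longrightarrow> (\<psi> has_derivative (\<psi>' y)) (at y)"
    "\<And>y. y \<in> W \<Longrightarrow> \<psi>' y = inv (blinfun_apply (\<phi>' (\<psi> y)))"
    "\<And>y. y \<in> W \<Longrightarrow> bij (blinfun_apply (\<phi>' (\<psi> y)))"
    using inverse_function_theorem[OF U der\<phi> cont x0 inv0] by metis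
  have inv: "\<exists>c d. \<psi>' y = (\<lambda>v. (fst c * fst v + fst d * snd v, snd c * fst v + snd d * snd v))"
    if y: "y \<in> W" for y
  proof -
    let ?x = "\<psi> y"
    define D where "D = \<alpha> * b ?x - \<beta> * a ?x"
    have inj: "inj (L ?x)" using *(9)[OF y] by (simp add: bij_is_inj)
    have "D \<noteq> 0"
    proof
      assume "D = 0"
      \<comment> \<open>If the determinant vanished, the columns of the cofactor matrix would lie in
        the kernel, and injectivity would make all four entries of the matrix zero.\<close>
      have "L ?x (b ?x, - a ?x) = L ?x 0" "L ?x (\<beta>, - \<alpha>) = L ?x 0"
        using \<open>D = 0\<close> by (simp_all add: L_def D_def algebra_simps)
      with inj have "(b ?x, - a ?x) = 0" "(\<beta>, - \<alpha>) = 0" by (auto dest: injD)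
      then have "L ?x (1, 1) = L ?x 0" by (simp add: L_def zero_prod_def)
      with inj have "(1, 1) = (0 :: complex \<times> complex)" by (rule injD)
      then show False by (simp add: zero_prod_def)
    qed
    have "inv (L ?x) v = (b ?x / D * fst v + (- \<beta> / D) * snd v, (- a ?x / D) * fst v + \<alpha> / D * snd v)" for v
    proof (rule inv_f_eq[OF inj])
      have "\<alpha> * (b ?x / D * fst v + (- \<beta> / D) * snd v) + \<beta> * ((- a ?x / D) * fst v + \<alpha> / D * snd v) =
          (\<alpha> * b ?x - \<beta> * a ?x) / D * fst v"
        "a ?x * (b ?x / D * fst v + (- \<beta> / D) * snd v) + b ?x * ((- a ?x / D) * fst v + \<alpha> / D * snd v) =
          (\<alpha> * b ?x - \<beta> * a ?x) / D * snd v"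
        by (simp_all add: algebra_simps diff_divide_distrib)
      then show "L ?x (b ?x / D * fst v + (- \<beta> / D) * snd v, (- a ?x / D) * fst v + \<alpha> / D * snd v) = v"
        using \<open>D \<noteq> 0\<close> by (simp add: L_def D_def[symmetric])
    qed
    then have "\<psi>' y = (\<lambda>v. (fst (b ?x / D, - a ?x / D) * fst v + fst (- \<beta> / D, \<alpha> / D) * snd v,
        snd (b ?x / D, - a ?x / D) * fst v + snd (- \<beta> / D, \<alpha> / D) * snd v))"
      using *(8)[OF y] by (simp add: fun_eq_iff)
    then show ?thesis by blast
  qed
  have h\<psi>: "holomorphic2_on (fst \<circ> \<psi>) W \<and> holomorphic2_on (snd \<circ> \<psi>) W"
    unfolding holomorphic2_on_def
  proof (intro conjI ballI)
    fix y assume y: "y \<in> W"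
    from inv[OF y] obtain c d
      where cd: "\<psi>' y = (\<lambda>v. (fst c * fst v + fst d * snd v, snd c * fst v + snd d * snd v))" by blast
    have "((fst \<circ> \<psi>) has_derivative (\<lambda>(h, k). fst c * h + fst d * k)) (at y)"
      using has_derivative_fst[OF *(7)[OF y]] by (simp add: cd o_def case_prod_unfold)
    then show "\<exists>a b. ((fst \<circ> \<psi>) has_derivative (\<lambda>(h, k). a * h + b * k)) (at y)" by blast
    have "((snd \<circ> \<psi>) has_derivative (\<lambda>(h, k). snd c * h + snd d * k)) (at y)"
      using has_derivative_snd[OF *(7)[OF y]] by (simp add: cd o_def case_prod_unfold)
    then show "\<exists>a b. ((snd \<circ> \<psi>) has_derivative (\<lambda>(h, k). a * h + b * k)) (at y)" by blast
  qed
  have h\<phi>: "holomorphic2_on (fst \<circ> \<phi>) V \<and> holomorphic2_on (snd \<circ> \<phi>) V"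
    unfolding holomorphic2_on_def
  proof (intro conjI ballI)
    fix x assume x: "x \<in> V"
    have "((fst \<circ> \<phi>) has_derivative (\<lambda>(h, k). \<alpha> * h + \<beta> * k)) (at x)"
      unfolding \<phi>_def o_def case_prod_unfold fst_conv by (intro derivative_intros)
    then show "\<exists>a b. ((fst \<circ> \<phi>) has_derivative (\<lambda>(h, k). a * h + b * k)) (at x)" by blast
    have "((snd \<circ> \<phi>) has_derivative (\<lambda>(h, k). a x * h + b x * k)) (at x)"
      using der[of x] x *(2) by (auto simp: \<phi>_def o_def)
    then show "\<exists>a b. ((snd \<circ> \<phi>) has_derivative (\<lambda>(h, k). a * h + b * k)) (at x)" by blast
  qed
  have "biholomorphism2 V W \<phi> \<psi>"
    unfolding biholomorphism2_def using * h\<phi> h\<psi> by blast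
  then show ?thesis
    using that[of V W \<phi> \<psi>] * by (simp add: \<phi>_def)
qed

text \<open>\<open>smooth_at\<close> asks for charts at all points of a neighbourhood, hence the
  open set \<open>N\<close> on which the gradient stays nonzero.\<close>

lemma smooth_at_regular_point:
  fixes f a b :: "complex \<times> complex \<Rightarrow> complex"
  assumes U: "open U" and der: "\<And>x. x \<in> U \<Longrightarrow> (f has_derivative (\<lambda>(h, k). a x * h + b x * k)) (at x)"
    and conta: "continuous_on U a" and contb: "continuous_on U b"
    and x0: "x0 \<in> U" and reg: "a x0 \<noteq> 0 \<or> b x0 \<noteq> 0"
    and A: "A = {x \<in> U. f x = 0}"
  shows "smooth_at A U x0"
proof -
  define N where "N = {x \<in> U. a x \<noteq> 0} \<union> {x \<in> U. b x \<noteq> 0}"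
  have "{x \<in> U. a x \<noteq> 0} = U \<inter> a -` (- {0})" "{x \<in> U. b x \<noteq> 0} = U \<inter> b -` (- {0})" by auto
  then have oN: "open N"
    unfolding N_def using continuous_open_preimage[OF conta U, of "- {0}"]
      continuous_open_preimage[OF contb U, of "- {0}"] by (auto intro: open_Un)
  have NU: "N \<subseteq> U" by (auto simp: N_def)
  have "analytic_curve_submanifold (A \<inter> N) U"
    unfolding analytic_curve_submanifold_def
  proof (intro conjI ballI)
    show "A \<inter> N \<subseteq> U" using NU by auto
    fix p assume p: "p \<in> A \<inter> N"
    obtain V W \<phi> \<psi> where *: "p \<in> V" "V \<subseteq> N" "biholomorphism2 V W \<phi> \<psi>" "\<And>x. snd (\<phi> x) = f x"
    proof (rule regular_point_chart[OF oN, of f a b p])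
      show "(f has_derivative (\<lambda>(h, k). a x * h + b x * k)) (at x)" if "x \<in> N" for x
        by (rule der) (use that NU in blast)
      show "continuous_on N a" "continuous_on N b"
        using conta contb NU continuous_on_subset by blast+
      show "p \<in> N" "a p \<noteq> 0 \<or> b p \<noteq> 0" using p by (auto simp: N_def)
    qed (rule that)
    have W: "\<phi> ` V = W"
      using *(3) by (auto simp: biholomorphism2_def homeomorphism_def)
    have "\<phi> ` (A \<inter> N \<inter> V) = {w \<in> W. snd w = 0}"
    proof (intro equalityI subsetI)
      fix w assume "w \<in> \<phi> ` (A \<inter> N \<inter> V)"
      then show "w \<in> {w \<in> W. snd w = 0}" using W *(4) by (auto simp: A)
    next
      fix w assume w: "w \<in> {w \<in> W. snd w = 0}"
      then obtain x where x: "x \<in> V" "w = \<phi> x" using W by auto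
      then have "x \<in> A \<inter> N \<inter> V" using w *(2,4) NU by (auto simp: A)
      then show "w \<in> \<phi> ` (A \<inter> N \<inter> V)" using x by auto
    qed
    then show "\<exists>V W \<phi> \<psi>. p \<in> V \<and> V \<subseteq> U \<and> biholomorphism2 V W \<phi> \<psi> \<and>
        \<phi> ` (A \<inter> N \<inter> V) = {w \<in> W. snd w = 0}"
      using * NU by blast
  qed
  moreover have "x0 \<in> N" using x0 reg by (auto simp: N_def)
  ultimately show ?thesis
    unfolding smooth_at_def using oN NU by blast
qed

section \<open>The heat equation and zeros of order one or two\<close>

definition theta_dzz :: "complex \<Rightarrow> complex \<Rightarrow> complex" where
  "theta_dzz q z = (\<Sum>n. diffs (diffs (\<lambda>n. q ^ tri n)) n * z ^ n)"

context
  fixes q :: complex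
  assumes q: "norm q < 1"
begin

lemma summable_theta': "summable (\<lambda>n. q ^ tri n * z ^ n)"
  by (rule summable_theta[OF q])

lemma summable_theta_diffs: "summable (\<lambda>n. diffs (\<lambda>n. q ^ tri n) n * z ^ n)"
  by (rule termdiff_converges_all[OF summable_theta'])

lemma summable_theta_diffs2: "summable (\<lambda>n. diffs (diffs (\<lambda>n. q ^ tri n)) n * z ^ n)"
  by (rule termdiff_converges_all[OF summable_theta_diffs])

lemma theta_dz_diffs: "theta_dz (q, z) = (\<Sum>n. diffs (\<lambda>n. q ^ tri n) n * z ^ n)"
  using diffs_equiv[OF summable_theta_diffs[of z]] by (simp add: theta_dz_def sums_iff)

lemma has_field_derivative_theta_z:
  "(partial_theta q has_field_derivative theta_dz (q, z)) (at z)"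
  using termdiffs_strong_converges_everywhere[OF summable_theta', of z]
  by (simp add: theta_dz_diffs partial_theta_tri[abs_def])

lemma has_field_derivative_theta_dz:
  "((\<lambda>z. theta_dz (q, z)) has_field_derivative theta_dzz q z) (at z)"
  using termdiffs_strong_converges_everywhere[OF summable_theta_diffs, of z]
  by (simp add: theta_dz_diffs theta_dzz_def)

text \<open>Comparison of coefficients: n (n - 1) + 2 n = n (n + 1) = 2 tri n.\<close>

lemma theta_heat_equation:
  "2 * q * theta_dq (q, z) = z\<^sup>2 * theta_dzz q z + 2 * z * theta_dz (q, z)"
proof -
  define c where "c n = q ^ tri n" for n
  have "(\<lambda>n. z * (of_nat n * c n * z ^ (n - Suc 0))) sums (z * theta_dz (q, z))"
    unfolding theta_dz_diffs c_def by (rule sums_mult[OF diffs_equiv[OF summable_theta_diffs]])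
  also have "(\<lambda>n. z * (of_nat n * c n * z ^ (n - Suc 0))) = (\<lambda>n. of_nat n * c n * z ^ n)"
    by (rule ext, case_tac n) auto
  finally have 1: "(\<lambda>n. of_nat n * c n * z ^ n) sums (z * theta_dz (q, z))" .
  have "(\<lambda>n. z\<^sup>2 * (diffs (diffs c) n * z ^ n)) sums (z\<^sup>2 * theta_dzz q z)"
    unfolding theta_dzz_def c_def by (rule sums_mult[OF summable_sums[OF summable_theta_diffs2]])
  also have "(\<lambda>n. z\<^sup>2 * (diffs (diffs c) n * z ^ n)) =
      (\<lambda>n. (\<lambda>m. of_nat m * (of_nat m - 1) * c m * z ^ m) (n + 2))"
    by (rule ext) (simp add: diffs_def power2_eq_square algebra_simps)
  \<comment> \<open>The two terms lost in the shift, m = 0 and m = 1, are zero.\<close>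
  finally have 2: "(\<lambda>m. of_nat m * (of_nat m - 1) * c m * z ^ m) sums (z\<^sup>2 * theta_dzz q z)"
    by (subst (asm) sums_iff_shift) (simp add: numeral_2_eq_2)
  have "(\<lambda>n. of_nat n * (of_nat n - 1) * c n * z ^ n + 2 * (of_nat n * c n * z ^ n)) sums
      (z\<^sup>2 * theta_dzz q z + 2 * (z * theta_dz (q, z)))"
    by (intro sums_add 2 sums_mult 1)
  also have "(\<lambda>n. of_nat n * (of_nat n - 1) * c n * z ^ n + 2 * (of_nat n * c n * z ^ n)) =
      (\<lambda>n. 2 * q * (of_nat (tri n) * q ^ (tri n - 1) * z ^ n))"
  proof
    fix n
    have "of_nat (2 * tri n) = (of_nat n * (of_nat n + 1) :: complex)"
      by (simp only: two_tri of_nat_mult of_nat_add of_nat_1)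
    then have t: "of_nat n * (of_nat n - 1) + 2 * of_nat n = (2 * of_nat (tri n) :: complex)"
      by (simp add: algebra_simps)
    have "of_nat (tri n) * c n = q * (of_nat (tri n) * q ^ (tri n - 1))"
      unfolding c_def by (cases "tri n") auto
    have "2 * q * (of_nat (tri n) * q ^ (tri n - 1) * z ^ n) = 2 * (q * (of_nat (tri n) * q ^ (tri n - 1))) * z ^ n"
      by (simp only: mult_ac)
    also have "\<dots> = (2 * of_nat (tri n)) * c n * z ^ n"
      by (simp only: \<open>of_nat (tri n) * c n = q * (of_nat (tri n) * q ^ (tri n - 1))\<close>[symmetric] mult_ac)
    finally have "2 * q * (of_nat (tri n) * q ^ (tri n - 1) * z ^ n) = (2 * of_nat (tri n)) * c n * z ^ n" .
    then show "of_nat n * (of_nat n - 1) * c n * z ^ n + 2 * (of_nat n * c n * z ^ n) =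
        2 * q * (of_nat (tri n) * q ^ (tri n - 1) * z ^ n)"
      by (simp only: t[symmetric]) (simp only: algebra_simps)
  qed
  finally have *: "(\<lambda>n. 2 * q * (of_nat (tri n) * q ^ (tri n - 1) * z ^ n)) sums
      (z\<^sup>2 * theta_dzz q z + 2 * (z * theta_dz (q, z)))" .
  show ?thesis
  \<comment> \<open>Summability of the \<open>theta_dq\<close> series is obtained by cancelling 2 q,
    hence the separate case.\<close>
  proof (cases "q = 0")
    case True
    then show ?thesis using * by (simp add: sums_iff mult.assoc)
  next
    case False
    then have "summable (\<lambda>n. of_nat (tri n) * q ^ (tri n - 1) * z ^ n)"
      using sums_summable[OF *] by (subst (asm) summable_cmult_iff) auto
    then have "(\<lambda>n. 2 * q * (of_nat (tri n) * q ^ (tri n - 1) * z ^ n)) sums (2 * q * theta_dq (q, z))"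
      unfolding theta_dq_def by (auto intro!: sums_mult summable_sums)
    then show ?thesis using sums_unique2[OF *] by (simp add: mult.assoc)
  qed
qed

text \<open>Write theta(q, w) = g(w) (w - z)^n with g(z) \<noteq> 0. For n = 1 the first derivative
  at z is g(z); for n = 2 the second derivative is 2 g(z).\<close>

lemma zorder_imp_regular:
  assumes "zorder (partial_theta q) z = 1 \<or> zorder (partial_theta q) z = 2"
  shows "theta_dz (q, z) \<noteq> 0 \<or> theta_dzz q z \<noteq> 0"
proof (rule ccontr)
  assume "\<not> ?thesis"
  then have 0: "theta_dz (q, z) = 0" "theta_dzz q z = 0" by auto
  have hol: "partial_theta q holomorphic_on UNIV"
    using has_field_derivative_theta_z field_differentiable_def by (intro holomorphic_onI) blast
  let ?n = "nat (zorder (partial_theta q) z)"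
  let ?g = "zor_poly (partial_theta q) z"
  have "\<exists>w\<in>UNIV. partial_theta q w \<noteq> 0"
    using partial_theta_z0[OF q] by (intro bexI[of _ 0]) auto
  from zorder_exist_zero[OF hol open_UNIV connected_UNIV UNIV_I[of z] this] obtain r
    where r: "r > 0" "?g holomorphic_on cball z r"
      and eq: "\<And>w. w \<in> cball z r \<Longrightarrow> partial_theta q w = ?g w * (w - z) ^ ?n \<and> ?g w \<noteq> 0"
    by blast
  have gz: "?g z \<noteq> 0" using eq r by simp
  have z: "z \<in> ball z r" using r by simp
  have hg: "?g holomorphic_on ball z r"
    using r(2) by (rule holomorphic_on_subset) auto
  have dg: "(?g has_field_derivative deriv ?g w) (at w)" if "w \<in> ball z r" for w
    using holomorphic_derivI[OF hg open_ball that] .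
  have hdg: "deriv ?g holomorphic_on ball z r"
    using hg by (rule holomorphic_deriv) simp
  have dz: "theta_dz (q, w) = deriv ?g w * (w - z) ^ ?n + of_nat ?n * (w - z) ^ (?n - 1) * ?g w"
    if w: "w \<in> ball z r" for w
  proof (rule DERIV_unique)
    show "(partial_theta q has_field_derivative theta_dz (q, w)) (at w)"
      by (rule has_field_derivative_theta_z)
    have "((\<lambda>w. ?g w * (w - z) ^ ?n) has_field_derivative
       deriv ?g w * (w - z) ^ ?n + of_nat ?n * (w - z) ^ (?n - 1) * ?g w) (at w)"
      using w by (auto intro!: derivative_eq_intros dg)
    then show "(partial_theta q has_field_derivative
       deriv ?g w * (w - z) ^ ?n + of_nat ?n * (w - z) ^ (?n - 1) * ?g w) (at w)"
      by (rule has_field_derivative_transform_within_open[OF _ open_ball w]) (simp add: eq)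
  qed
  from assms show False
  proof
    assume "zorder (partial_theta q) z = 1"
    then show False using dz[OF z] 0 gz by simp
  next
    assume n: "zorder (partial_theta q) z = 2"
    have ddg: "(deriv ?g has_field_derivative deriv (deriv ?g) z) (at z)"
      using holomorphic_derivI[OF hdg open_ball z] .
    have "((\<lambda>w. deriv ?g w * (w - z) ^ 2 + 2 * (w - z) * ?g w) has_field_derivative 2 * ?g z) (at z)"
      by (auto intro!: derivative_eq_intros dg[OF z] ddg)
    then have "((\<lambda>w. theta_dz (q, w)) has_field_derivative 2 * ?g z) (at z)"
      by (rule has_field_derivative_transform_within_open[OF _ open_ball z]) (simp add: dz n)
    then show False
      using DERIV_unique[OF has_field_derivative_theta_dz] 0 gz by fastforce
  qed
qed

end

lemma theta_zeros_eq: "theta_zeros = {x \<in> theta_domain. (\<lambda>(q, z). partial_theta q z) x = 0}"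
  by (auto simp: theta_zeros_def)

lemma analytic_subset_theta_zeros: "analytic_subset theta_zeros theta_domain"
  unfolding analytic_subset_def
proof (intro conjI ballI)
  show "theta_zeros \<subseteq> theta_domain" by (auto simp: theta_zeros_def)
  fix p assume p: "p \<in> theta_domain"
  have "holomorphic2_on (\<lambda>(q, z). partial_theta q z) theta_domain"
    unfolding holomorphic2_on_def using has_derivative_theta by blast
  then show "\<exists>V F. open V \<and> p \<in> V \<and> V \<subseteq> theta_domain \<and> finite F \<and>
        (\<forall>f\<in>F. holomorphic2_on f V) \<and> theta_zeros \<inter> V = {x \<in> V. \<forall>f\<in>F. f x = 0}"
    using p by (intro exI[of _ theta_domain] exI[of _ "{\<lambda>(q, z). partial_theta q z}"])
      (auto simp: open_theta_domain theta_zeros_def)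
qed

lemma theta_zero_nonzero:
  assumes "(q, z) \<in> theta_zeros"
  shows "q \<noteq> 0" "z \<noteq> 0"
  using assms partial_theta_z0[of q] by (auto simp: theta_zeros_iff)

lemma smooth_at_theta_zeros:
  assumes "(q, z) \<in> theta_zeros" "zorder (partial_theta q) z = 1 \<or> zorder (partial_theta q) z = 2"
  shows "smooth_at theta_zeros theta_domain (q, z)"
proof (rule smooth_at_regular_point[OF open_theta_domain has_derivative_theta
      continuous_on_theta_dq continuous_on_theta_dz _ _ theta_zeros_eq])
  have q: "norm q < 1" using assms by (simp add: theta_zeros_iff)
  then show "(q, z) \<in> theta_domain" by (simp add: theta_domain_def)
  show "theta_dq (q, z) \<noteq> 0 \<or> theta_dz (q, z) \<noteq> 0"
    using zorder_imp_regular[OF q assms(2)] theta_heat_equation[OF q, of z]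
      theta_zero_nonzero[OF assms(1)] by auto
qed

section \<open>Branches of zeros near q = 0\<close>

text \<open>This is theta divided by its term of index m, in the variable t = z q^(m+1). The terms
  of index m and m + 1 become 1 and t, the term of index m - l becomes q^(tri l) / t^l, so for small
  q the window is close to 1 + t.\<close>

definition theta_window :: "nat \<Rightarrow> complex \<Rightarrow> complex \<Rightarrow> complex" where
  "theta_window m q t = (\<Sum>l<Suc m. q ^ tri l / t ^ l) + t * partial_theta q t"

lemma theta_shift:
  assumes "norm q < 1" "q \<noteq> 0" "t \<noteq> 0"
  shows "q ^ tri m * partial_theta q (t / q ^ Suc m) = t ^ m * theta_window m q t"
proof -
  define z where "z = t / q ^ Suc m"
  have t: "t = z * q ^ Suc m" using assms by (simp add: z_def)
  have "q ^ tri m * partial_theta q z = (\<Sum>j<Suc m. q ^ tri m * (q ^ tri j * z ^ j)) +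
      q ^ tri m * (z ^ Suc m * q ^ tri (Suc m)) * partial_theta q (q ^ Suc m * z)"
    by (subst partial_theta_split[OF assms(1), of z "Suc m"])
       (simp only: distrib_left sum_distrib_left mult.assoc)
  \<comment> \<open>Reversing the order, l = m - j, makes the sum start at the dominant
    term.\<close>
  also have "(\<Sum>j<Suc m. q ^ tri m * (q ^ tri j * z ^ j)) =
      (\<Sum>l<Suc m. q ^ tri m * (q ^ tri (Suc m - Suc l) * z ^ (Suc m - Suc l)))"
    by (rule sum.nat_diff_reindex[symmetric])
  also have "\<dots> = (\<Sum>l<Suc m. t ^ m * (q ^ tri l / t ^ l))"
  proof (rule sum.cong[OF refl])
    fix l assume "l \<in> {..<Suc m}"
    then obtain n where m: "m = n + l" by (metis add.commute le_Suc_ex lessThan_iff less_Suc_eq_le)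
    have "tri m + tri n = tri l + Suc m * n"
      using two_tri[of n] by (simp add: m tri_add algebra_simps)
    then have "q ^ tri m * q ^ tri n = q ^ tri l * q ^ (Suc m * n)"
      by (metis power_add)
    then have "q ^ tri m * (q ^ tri n * z ^ n) = q ^ tri l * t ^ n"
      by (simp only: t power_mult_distrib flip: power_mult) (metis mult.left_commute mult.commute)
    also have "\<dots> = t ^ m * (q ^ tri l / t ^ l)"
      using assms by (simp add: m power_add)
    finally show "q ^ tri m * (q ^ tri (Suc m - Suc l) * z ^ (Suc m - Suc l)) = t ^ m * (q ^ tri l / t ^ l)"
      by (simp add: m)
  qed
  also have "q ^ tri m * (z ^ Suc m * q ^ tri (Suc m)) = t ^ Suc m"
  proof -
    have "tri m + tri (Suc m) = Suc m * Suc m"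
      using two_tri[of m] by (simp add: tri_Suc)
    then have "q ^ tri m * q ^ tri (Suc m) = (q ^ Suc m) ^ Suc m"
      by (metis power_add power_mult)
    then have "q ^ tri m * (z ^ Suc m * q ^ tri (Suc m)) = z ^ Suc m * (q ^ Suc m) ^ Suc m"
      by (metis mult.left_commute)
    then show ?thesis by (simp only: t power_mult_distrib)
  qed
  also have "q ^ Suc m * z = t" by (simp add: t)
  finally show ?thesis
    by (simp add: z_def theta_window_def distrib_left sum_distrib_left mult.assoc)
qed

lemma theta_zero_iff_window:
  assumes "norm q < 1" "q \<noteq> 0" "z \<noteq> 0"
  shows "partial_theta q z = 0 \<longleftrightarrow> theta_window m q (z * q ^ Suc m) = 0"
proof -
  have "q ^ tri m * partial_theta q z = (z * q ^ Suc m) ^ m * theta_window m q (z * q ^ Suc m)"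
    using theta_shift[OF assms(1,2), of "z * q ^ Suc m" m] assms by simp
  moreover have "q ^ tri m \<noteq> 0" "(z * q ^ Suc m) ^ m \<noteq> 0" using assms by simp_all
  ultimately show ?thesis by (metis mult_eq_0_iff)
qed

text \<open>Behind this is that the two-sided series over all integers vanishes at z = -1, where j
  and -1 - j cancel. In window form: at t = -1 the finite sum is the beginning of theta(q, -1), so
  the window is minus the tail of that series, which \<open>partial_theta_split\<close>
  evaluates.\<close>

lemma theta_reflect:
  assumes "norm q < 1" "q \<noteq> 0"
  shows "partial_theta q (- 1 / q ^ n) = q ^ n * partial_theta q (- (q ^ n))"
proof (cases n)
  case (Suc m)
  have "1 / (- 1) ^ l = ((- 1) ^ l :: complex)" for l :: nat
    by (cases "even l") simp_all
  then have "(\<Sum>l<n. q ^ tri l / (- 1) ^ l) = (\<Sum>l<n. q ^ tri l * (- 1) ^ l)"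
    by (intro sum.cong refl) (metis times_divide_eq_right mult.right_neutral)
  moreover have "partial_theta q (- 1) =
      (\<Sum>l<n. q ^ tri l * (- 1) ^ l) + (- 1) ^ n * q ^ tri n * partial_theta q (- (q ^ n))"
    using partial_theta_split[OF assms(1), of "- 1" n] by simp
  ultimately have "theta_window m q (- 1) = - ((- 1) ^ n * q ^ tri n * partial_theta q (- (q ^ n)))"
    unfolding theta_window_def Suc by simp
  then have "q ^ tri m * partial_theta q (- 1 / q ^ n) =
      (- 1) ^ m * - ((- 1) ^ n * q ^ tri n * partial_theta q (- (q ^ n)))"
    using theta_shift[OF assms, of "- 1" m] Suc by simp
  also have "\<dots> = ((- 1) ^ m * (- 1) ^ m) * (q ^ tri m * q ^ n * partial_theta q (- (q ^ n)))"
    by (simp add: Suc tri_Suc power_add)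
  also have "(- 1) ^ m * (- 1) ^ m = (1 :: complex)" by (simp flip: power_mult_distrib)
  finally have "q ^ tri m * partial_theta q (- 1 / q ^ n) =
      q ^ tri m * (q ^ n * partial_theta q (- (q ^ n)))" by simp
  then show ?thesis using assms by simp
qed simp

lemma norm_window_sum_le:
  fixes q t :: complex
  assumes "norm q \<le> 1" "norm q < norm t"
  shows "norm ((\<Sum>l<Suc m. q ^ tri l / t ^ l) - 1) \<le> norm q / (norm t - norm q)"
proof -
  define x where "x = norm q / norm t"
  have t: "norm t > 0" using assms norm_ge_zero[of q] by linarith
  have x: "0 \<le> x" "x < 1" using assms t by (auto simp: x_def)
  have "(\<Sum>l<Suc m. q ^ tri l / t ^ l) - 1 = (\<Sum>l<m. q ^ tri (Suc l) / t ^ Suc l)"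
    by (subst sum.lessThan_Suc_shift) (simp del: sum.lessThan_Suc)
  also have "norm \<dots> \<le> (\<Sum>l<m. x * x ^ l)"
  proof (rule sum_norm_le)
    fix l
    have "norm q ^ tri (Suc l) \<le> norm q ^ Suc l"
      using assms by (intro power_decreasing tri_ge) auto
    then have "norm (q ^ tri (Suc l) / t ^ Suc l) \<le> norm q ^ Suc l / norm t ^ Suc l"
      unfolding norm_divide norm_power by (intro divide_right_mono) auto
    then show "norm (q ^ tri (Suc l) / t ^ Suc l) \<le> x * x ^ l"
      by (simp add: x_def power_divide)
  qed
  also have "\<dots> \<le> (\<Sum>l. x * x ^ l)"
    using x by (intro sum_le_suminf summable_mult summable_geometric) auto
  also have "\<dots> = x / (1 - x)"
    using x by (subst suminf_mult) (auto simp: suminf_geometric intro!: summable_geometric)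
  also have "\<dots> = norm q / (norm t - norm q)"
    using t assms by (simp add: x_def field_simps)
  finally show ?thesis .
qed

definition window_rest :: "nat \<Rightarrow> complex \<Rightarrow> complex \<Rightarrow> complex" where
  "window_rest m q t = theta_window m q t - 1 - t"

lemma norm_window_rest_le:
  assumes "norm q < 1" "norm q < norm t" "norm q * norm t < 1"
  shows "norm (window_rest m q t) \<le>
    norm q / (norm t - norm q) + norm t * (norm q * norm t / (1 - norm q * norm t))"
proof -
  have "window_rest m q t = ((\<Sum>l<Suc m. q ^ tri l / t ^ l) - 1) + t * (partial_theta q t - 1)"
    by (simp add: window_rest_def theta_window_def algebra_simps)
  also have "norm \<dots> \<le> norm ((\<Sum>l<Suc m. q ^ tri l / t ^ l) - 1) + norm t * norm (partial_theta q t - 1)"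
    by (metis norm_mult norm_triangle_ineq)
  also have "\<dots> \<le> norm q / (norm t - norm q) + norm t * (norm q * norm t / (1 - norm q * norm t))"
    using assms by (intro add_mono norm_window_sum_le mult_left_mono norm_partial_theta_minus_1_le) auto
  finally show ?thesis .
qed

text \<open>The annulus contains the closed disc of radius 3/4 about -1, where the window is
  compared with 1 + t.\<close>

lemma norm_window_rest_small:
  assumes q: "norm q \<le> 1/100" and t: "1/4 \<le> norm t" "norm t \<le> 7/4"
  shows "norm (window_rest m q t) \<le> 1/10"
proof -
  have "norm q * norm t \<le> 1/100 * (7/4)" using q t by (intro mult_mono) auto
  then have x: "norm q * norm t \<le> 7/400" by simp
  have "norm (window_rest m q t) \<le>
      norm q / (norm t - norm q) + norm t * (norm q * norm t / (1 - norm q * norm t))"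
    using q t x by (intro norm_window_rest_le) auto
  also have "\<dots> \<le> (1/100) / (1/4 - 1/100) + 7/4 * ((7/400) / (1 - 7/400))"
    using q t x by (intro add_mono mult_mono frac_le) auto
  also have "\<dots> \<le> 1/10" by simp
  finally show ?thesis .
qed

lemma norm_near_minus_1:
  fixes t :: complex
  assumes "t \<in> cball (- 1) (3/4)"
  shows "1/4 \<le> norm t" "norm t \<le> 7/4"
proof -
  have "norm (t + 1) \<le> 3/4" using assms by (simp add: dist_norm norm_minus_commute add.commute)
  then show "1/4 \<le> norm t" "norm t \<le> 7/4"
    using norm_triangle_ineq4[of "t + 1" t] norm_triangle_ineq4[of "t + 1" 1] by auto
qed

lemma window_rest_holomorphic:
  assumes "norm q < 1" "open S" "0 \<notin> S"
  shows "window_rest m q holomorphic_on S"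
  unfolding window_rest_def theta_window_def
  using assms by (auto intro!: holomorphic_intros holomorphic_on_theta_comp)

text \<open>Cauchy's estimate on discs of radius 1/5, which stay within distance 3/4 of -1 because
  1/2 + 1/5 < 3/4, turns the bound 1/10 into (1/10) / (1/5) = 1/2 for the derivative.\<close>

lemma window_rest_lipschitz:
  assumes q: "norm q \<le> 1/100" and s: "s \<in> cball (- 1) (1/2)" and t: "t \<in> cball (- 1) (1/2)"
  shows "norm (window_rest m q s - window_rest m q t) \<le> 1/2 * norm (s - t)"
proof (rule field_differentiable_bound[where S = "cball (- 1) (1/2)" and f' = "deriv (window_rest m q)"])
  have sub: "cball w (1/5) \<subseteq> ball (- 1) (3/4)" if "w \<in> cball (- 1) (1/2)" for w :: complex
  proof
    fix v assume "v \<in> cball w (1/5)"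
    then show "v \<in> ball (- 1) (3/4)"
      using that dist_triangle[of "- 1" v w] by auto
  qed
  have hol: "window_rest m q holomorphic_on ball (- 1) (3/4)"
    using q by (intro window_rest_holomorphic) auto
  fix w assume w: "w \<in> cball (- 1 :: complex) (1/2)"
  show "(window_rest m q has_field_derivative deriv (window_rest m q) w) (at w within cball (- 1) (1/2))"
    by (rule holomorphic_derivI[OF hol]) (use w in auto)
  have "norm ((deriv ^^ 1) (window_rest m q) w) \<le> fact 1 * (1/10) / (1/5) ^ 1"
  proof (rule Cauchy_inequality)
    show "window_rest m q holomorphic_on ball w (1/5)"
      using hol by (rule holomorphic_on_subset) (use sub[OF w] in auto)
    show "continuous_on (cball w (1/5)) (window_rest m q)"
      using hol sub[OF w] by (meson continuous_on_subset holomorphic_on_imp_continuous_on)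
    fix x assume "norm (w - x) = 1/5"
    then have "x \<in> cball w (1/5)" by (simp add: dist_norm)
    then have "x \<in> cball (- 1) (3/4)" using sub[OF w] by auto
    then show "norm (window_rest m q x) \<le> 1/10"
      using norm_near_minus_1 q by (intro norm_window_rest_small) auto
  qed simp
  then show "norm (deriv (window_rest m q) w) \<le> 1/2" by simp
qed (use assms in auto)

text \<open>Indexing: \<open>branch m\<close> is the graph of the zero close to \<open>- 1 / q ^ (m + 1)\<close>.\<close>

definition branch :: "nat \<Rightarrow> (complex \<times> complex) set" where
  "branch m = {(q, z) \<in> theta_zeros. norm q < 1/100 \<and> norm (z * q ^ Suc m + 1) \<le> 1/2}"

text \<open>Zeros of the window are the fixed points of t \<mapsto> -1 -
  \<open>window_rest m q t\<close>, which maps the disc into itself and contracts by 1/2.\<close>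

lemma branch_root:
  assumes "norm q \<le> 1/100"
  shows "\<exists>!t. t \<in> cball (- 1) (1/2) \<and> theta_window m q t = 0"
proof -
  let ?C = "cball (- 1 :: complex) (1/2)"
  have "\<exists>!t\<in>?C. - 1 - window_rest m q t = t"
  proof (rule Banach_fix[where c = "1/2"])
    show "complete ?C" by (simp add: compact_imp_complete)
    show "(\<lambda>t. - 1 - window_rest m q t) ` ?C \<subseteq> ?C"
    proof safe
      fix t assume "t \<in> ?C"
      then have "t \<in> cball (- 1) (3/4)" by auto
      then have "norm (window_rest m q t) \<le> 1/10"
        using norm_near_minus_1 assms by (intro norm_window_rest_small) auto
      then show "- 1 - window_rest m q t \<in> ?C" by (simp add: dist_norm)
    qed
    fix s t assume "s \<in> ?C" "t \<in> ?C"
    then show "dist (- 1 - window_rest m q s) (- 1 - window_rest m q t) \<le> 1/2 * dist s t"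
      using window_rest_lipschitz[OF assms, of s t m]
      by (simp add: dist_norm norm_minus_commute)
  qed auto
  moreover have "- 1 - window_rest m q t = t \<longleftrightarrow> theta_window m q t = 0" for t
    by (auto simp: window_rest_def)
  ultimately show ?thesis by simp
qed

text \<open>The branch is the graph of a continuous function over a punctured disc. The fixed point
  \<open>\<tau> q\<close> is continuous by contraction: if the map moves by d at the old fixed
  point, the fixed point moves by at most 2 d.\<close>

lemma connected_branch: "connected (branch m)"
proof -
  define \<tau> where "\<tau> q = (THE t. t \<in> cball (- 1) (1/2) \<and> theta_window m q t = 0)" for q
  have \<tau>: "\<tau> q \<in> cball (- 1) (1/2)" "theta_window m q (\<tau> q) = 0" if "norm q \<le> 1/100" for q
    using theI'[OF branch_root[OF that, of m]] by (auto simp: \<tau>_def)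
  have \<tau>_unique: "t = \<tau> q" if "norm q \<le> 1/100" "t \<in> cball (- 1) (1/2)" "theta_window m q t = 0" for q t
    using branch_root[OF that(1), of m] \<tau>[OF that(1)] that by blast
  let ?D = "ball (0 :: complex) (1/100) - {0}"
  have dist_minus_1: "dist (- 1) t = norm (t + 1)" for t :: complex
  proof -
    have "- 1 - t = - (t + 1)" by simp
    then show ?thesis unfolding dist_norm by (simp only: norm_minus_cancel)
  qed
  have "continuous_on ?D \<tau>"
  proof (rule continuous_at_imp_continuous_on, rule ballI)
    fix q0 assume q0: "q0 \<in> ?D"
    define t0 where "t0 = \<tau> q0"
    have q0': "norm q0 \<le> 1/100" using q0 by simp
    have t0: "t0 \<in> cball (- 1) (1/2)" using \<tau>(1)[OF q0'] by (simp add: t0_def)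
    have "t0 \<noteq> 0" using t0 by (auto simp: dist_norm)
    have "continuous_on (ball 0 (1/100)) (\<lambda>q. window_rest m q t0)"
      unfolding window_rest_def theta_window_def using \<open>t0 \<noteq> 0\<close>
      by (intro continuous_intros continuous_on_theta_comp) auto
    then have "isCont (\<lambda>q. window_rest m q t0) q0"
      using q0 by (simp add: continuous_on_eq_continuous_at)
    then have lim: "((\<lambda>q. 2 * norm (window_rest m q t0 - window_rest m q0 t0)) \<longlongrightarrow> 0) (at q0)"
      by (intro tendsto_eq_intros LIM_zero) (auto simp: isCont_def)
    have "((\<lambda>q. \<tau> q - t0) \<longlongrightarrow> 0) (at q0)"
    proof (rule Lim_null_comparison[OF _ lim])
      have "eventually (\<lambda>q. q \<in> ball 0 (1/100)) (at q0)"
        using q0 by (intro eventually_at_in_open') auto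
      then show "\<forall>\<^sub>F q in at q0. norm (\<tau> q - t0) \<le> 2 * norm (window_rest m q t0 - window_rest m q0 t0)"
      proof eventually_elim
        case (elim q)
        then have q: "norm q \<le> 1/100" by simp
        have "\<tau> q - t0 = (window_rest m q0 t0 - window_rest m q t0) - (window_rest m q (\<tau> q) - window_rest m q t0)"
          using \<tau>(2)[OF q] \<tau>(2)[OF q0'] by (simp add: window_rest_def t0_def)
        also have "norm \<dots> \<le> norm (window_rest m q0 t0 - window_rest m q t0) + norm (window_rest m q (\<tau> q) - window_rest m q t0)"
          by (rule norm_triangle_ineq4)
        also have "norm (window_rest m q (\<tau> q) - window_rest m q t0) \<le> 1/2 * norm (\<tau> q - t0)"
          by (rule window_rest_lipschitz[OF q \<tau>(1)[OF q] t0])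
        finally show ?case by (simp add: norm_minus_commute)
      qed
    qed
    then show "isCont \<tau> q0" unfolding isCont_def using LIM_zero_cancel t0_def by blast
  qed
  then have "continuous_on ?D (\<lambda>q. (q, \<tau> q / q ^ Suc m))"
    by (intro continuous_intros) auto
  moreover have "connected ?D"
    by (rule connected_punctured_ball) simp
  ultimately have "connected ((\<lambda>q. (q, \<tau> q / q ^ Suc m)) ` ?D)"
    by (rule connected_continuous_image)
  also have "(\<lambda>q. (q, \<tau> q / q ^ Suc m)) ` ?D = branch m"
  proof (intro equalityI subsetI)
    fix p assume "p \<in> (\<lambda>q. (q, \<tau> q / q ^ Suc m)) ` ?D"
    then obtain q where q: "q \<in> ?D" "p = (q, \<tau> q / q ^ Suc m)" by blast
    then have q': "norm q \<le> 1/100" "q \<noteq> 0" by auto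
    have "\<tau> q \<noteq> 0" using \<tau>(1)[OF q'(1)] by (auto simp: dist_norm)
    moreover have "norm (\<tau> q + 1) \<le> 1/2"
      using \<tau>(1)[OF q'(1)] by (simp only: mem_cball dist_minus_1)
    ultimately show "p \<in> branch m"
      using q q' \<tau>(2)[OF q'(1)] theta_zero_iff_window[of q "\<tau> q / q ^ Suc m" m]
      by (simp add: branch_def theta_zeros_iff)
  next
    fix p assume "p \<in> branch m"
    then obtain q z where p: "p = (q, z)" "(q, z) \<in> theta_zeros" "norm q < 1/100"
      "norm (z * q ^ Suc m + 1) \<le> 1/2" by (auto simp: branch_def)
    have nz: "q \<noteq> 0" "z \<noteq> 0"
      using p(2) partial_theta_z0[of q] by (auto simp: theta_zeros_iff)
    have "z * q ^ Suc m \<in> cball (- 1) (1/2)"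
      using p(4) by (simp only: mem_cball dist_minus_1)
    moreover have "theta_window m q (z * q ^ Suc m) = 0"
      using theta_zero_iff_window[of q z m] p nz by (simp add: theta_zeros_iff)
    ultimately have "z * q ^ Suc m = \<tau> q"
      using p(3) by (intro \<tau>_unique) auto
    then have "z = \<tau> q / q ^ Suc m" using nz by (simp add: field_simps)
    then show "p \<in> (\<lambda>q. (q, \<tau> q / q ^ Suc m)) ` ?D"
      using p nz by auto
  qed
  finally show ?thesis .
qed

text \<open>Some power q^k brings z into the annulus r < |t| \<le> 1/r with r = sqrt |q|, whose
  radii have ratio |q|. There |q| / |t| and |q t| are both at most r, so the window is close to 1 +
  t and a zero must lie near -1.\<close>

lemma small_zero_in_branch:
  assumes "(q, z) \<in> theta_zeros" "norm q < 1/100"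
  shows "\<exists>m. (q, z) \<in> branch m"
proof -
  have th: "partial_theta q z = 0" using assms by (simp add: theta_zeros_iff)
  have nz: "q \<noteq> 0" "z \<noteq> 0"
    using assms partial_theta_z0[of q] by (auto simp: theta_zeros_iff)
  define r where "r = sqrt (norm q)"
  have r: "0 < r" "r * r = norm q" using nz by (auto simp: r_def)
  have "r < sqrt ((1/10)^2)" unfolding r_def using assms by (intro real_sqrt_less_mono) (simp add: power2_eq_square)
  then have r10: "r < 1/10" by simp
  have "(\<lambda>k. norm z * norm q ^ k) \<longlonglongrightarrow> norm z * 0"
    using assms by (intro tendsto_intros LIMSEQ_power_zero) auto
  then have "eventually (\<lambda>k. norm z * norm q ^ k < 1 / r) sequentially"
    using r by (intro order_tendstoD) auto
  then obtain k0 where "norm z * norm q ^ k0 < 1 / r"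
    by (auto simp: eventually_sequentially)
  then have ex: "norm z * norm q ^ k0 \<le> 1 / r" by simp
  define k where "k = (LEAST k. norm z * norm q ^ k \<le> 1 / r)"
  have k: "norm z * norm q ^ k \<le> 1 / r"
    unfolding k_def by (rule LeastI[of "\<lambda>k. norm z * norm q ^ k \<le> 1 / r", OF ex])
  \<comment> \<open>For k = 0 the bound |q z| \<le> r < 1/10 would make theta nonzero. So k = m + 1,
    and the window of index m applies.\<close>
  have "k \<noteq> 0"
  proof
    assume "k = 0"
    then have "norm z \<le> 1 / r" using k by simp
    then have "norm q * norm z \<le> r * r * (1 / r)" using r by (intro mult_mono) auto
    also have "r * r * (1 / r) = r" using r(1) by simp
    finally have x: "norm q * norm z < 1/10" using r10 by linarith
    have "1 \<le> norm q * norm z / (1 - norm q * norm z)"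
      using norm_partial_theta_minus_1_le[of q z] assms x th by simp
    then show False using x by (simp add: field_simps)
  qed
  then obtain m where m: "k = Suc m" by (cases k) auto
  have "\<not> norm z * norm q ^ m \<le> 1 / r"
    unfolding k_def by (rule not_less_Least) (simp add: k_def[symmetric] m)
  define t where "t = z * q ^ Suc m"
  have t_up: "norm t * r \<le> 1" using k r by (simp add: t_def m norm_mult norm_power field_simps)
  have "norm t = norm z * norm q ^ m * (r * r)"
    using r by (simp add: t_def norm_mult norm_power)
  moreover have "norm z * norm q ^ m * (r * r) > 1 / r * (r * r)"
    using \<open>\<not> norm z * norm q ^ m \<le> 1 / r\<close> r by (intro mult_strict_right_mono) auto
  moreover have "1 / r * (r * r) = r" using r(1) by simp
  ultimately have t_lo: "r < norm t" by simp
  have "theta_window m q t = 0"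
    using theta_zero_iff_window[of q z m] th nz assms by (simp add: t_def)
  then have w: "norm (1 + t) = norm (window_rest m q t)"
    by (simp add: window_rest_def norm_minus_commute)
       (metis add.commute add_uminus_conv_diff minus_add_distrib norm_minus_cancel)
  have qr: "norm q \<le> r / 10" using r r10 mult_left_mono[of r "1/10" r] by simp
  have qt: "norm q * norm t \<le> r"
  proof -
    have "norm q * norm t = r * (norm t * r)" using r by simp
    also have "\<dots> \<le> r * 1" using r t_up by (intro mult_left_mono) auto
    finally show ?thesis by simp
  qed
  have bnd: "norm (1 + t) \<le> norm q / (norm t - norm q) + norm t * (norm q * norm t / (1 - norm q * norm t))"
    unfolding w using assms qr qt t_lo r r10 by (intro norm_window_rest_le) auto
  have "norm (1 + t) \<le> 1/2"
  \<comment> \<open>For |t| > 1 the error from the tail grows with |t|; it is absorbed through |t|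
    \<le> |1 + t| + 1.\<close>
  proof (cases "norm t \<le> 1")
    case True
    have "norm q * norm t \<le> 1/100 * 1" using assms True by (intro mult_mono) auto
    then have "norm t * (norm q * norm t / (1 - norm q * norm t)) \<le> 1 * ((1/100) / (1 - 1/100))"
      using True by (intro mult_mono frac_le) auto
    moreover have "norm q / (norm t - norm q) \<le> (r / 10) / (r - r / 10)"
      using qr t_lo r by (intro frac_le) auto
    ultimately show ?thesis using bnd r by (simp add: field_simps)
  next
    case False
    have "norm q / (norm t - norm q) \<le> (1/100) / (1 - 1/100)"
      using False assms by (intro frac_le) auto
    also have "\<dots> = 1/99" by simp
    finally have 1: "norm q / (norm t - norm q) \<le> 1/99" .
    have "norm q * norm t / (1 - norm q * norm t) \<le> (1/10) / (1 - 1/10)"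
      using qt r10 by (intro frac_le) auto
    then have 2: "norm t * (norm q * norm t / (1 - norm q * norm t)) \<le> norm t * (1/9)"
      by (intro mult_left_mono) auto
    have "norm t \<le> norm (1 + t) + 1"
      using norm_triangle_ineq4[of "1 + t" 1] by simp
    then show ?thesis using bnd 1 2 by linarith
  qed
  then show ?thesis
    using assms by (auto simp: branch_def t_def add.commute)
qed

section \<open>Every separated part of the zero set reaches small q\<close>

text \<open>The parts are cut out by closed sets of the ambient space, as in
  \<open>connected_closed\<close>; \<open>A\<close> and \<open>B\<close> may overlap off the zero
  set.\<close>

definition theta_separation :: "(complex \<times> complex) set \<Rightarrow> (complex \<times> complex) set \<Rightarrow> bool" where
  "theta_separation A B \<longleftrightarrow> closed A \<and> closed B \<and> theta_zeros \<subseteq> A \<union> B \<and> A \<inter> B \<inter> theta_zeros = {}"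

lemma theta_separation_sym: "theta_separation A B \<Longrightarrow> theta_separation B A"
  by (auto simp: theta_separation_def)

lemma theta_separation_connected:
  assumes "theta_separation A B" "connected C" "C \<subseteq> theta_zeros"
  shows "C \<subseteq> A \<or> C \<subseteq> B"
proof -
  have "A \<inter> C = {} \<or> B \<inter> C = {}"
    using assms by (intro connected_closedD) (auto simp: theta_separation_def)
  then show ?thesis using assms by (auto simp: theta_separation_def)
qed

text \<open>By the identity theorem a curve z q^k = const that lies locally in the zero set lies in
  it over the whole punctured disc. Being connected, it stays in \<open>A\<close>.\<close>

lemma zero_curve_reaches_small_q:
  assumes "theta_separation A B" "(q1, z1) \<in> A \<inter> theta_zeros"
    and "r > 0" "ball q1 r \<subseteq> ball 0 1 - {0}"
    and zero: "\<And>q. q \<in> ball q1 r \<Longrightarrow> partial_theta q (z1 * q1 ^ k / q ^ k) = 0"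
  shows "\<exists>q z. (q, z) \<in> A \<inter> theta_zeros \<and> norm q < 1/100"
proof -
  let ?D = "ball (0 :: complex) 1 - {0}"
  define g where "g q = partial_theta q (z1 * q1 ^ k / q ^ k)" for q
  have D: "open ?D" "connected ?D" by (auto intro: connected_punctured_ball)
  have "g holomorphic_on ?D"
    unfolding g_def using D by (intro holomorphic_on_theta_comp holomorphic_intros) auto
  then have g0: "g q = 0" if "q \<in> ?D" for q
    using analytic_continuation_open[of "ball q1 r" ?D g "\<lambda>_. 0" q] assms D that
    by (auto simp: g_def)
  let ?C = "(\<lambda>q. (q, z1 * q1 ^ k / q ^ k)) ` ?D"
  have "connected ?C"
    using D by (intro connected_continuous_image continuous_intros) auto
  moreover have "?C \<subseteq> theta_zeros"
  proof (rule image_subsetI)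
    fix q assume "q \<in> ?D"
    then show "(q, z1 * q1 ^ k / q ^ k) \<in> theta_zeros"
      using g0[of q] by (auto simp: theta_zeros_iff g_def)
  qed
  ultimately have "?C \<subseteq> A \<or> ?C \<subseteq> B"
    by (intro theta_separation_connected[OF assms(1)])
  moreover have "(q1, z1) \<in> ?C"
  proof -
    have "q1 \<in> ?D" using assms(3,4) by (meson centre_in_ball subsetD)
    then have "(\<lambda>q. (q, z1 * q1 ^ k / q ^ k)) q1 \<in> ?C" by blast
    then show ?thesis using \<open>q1 \<in> ?D\<close> by simp
  qed
  ultimately have "?C \<subseteq> A" using assms(1,2) unfolding theta_separation_def by blast
  moreover have "1/200 \<in> ?D" by (simp add: norm_divide)
  then have "(\<lambda>q. (q, z1 * q1 ^ k / q ^ k)) (1/200) \<in> ?C" by blast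
  ultimately have "(1/200, z1 * q1 ^ k / (1/200) ^ k) \<in> A \<inter> theta_zeros"
    using \<open>?C \<subseteq> theta_zeros\<close> by auto
  then show ?thesis by (intro exI conjI) (auto simp: norm_divide)
qed

text \<open>The functions q \<mapsto> theta(q, x c / q^k) have no zeros on the ball for x < 1 close
  to 1 and converge locally uniformly as x tends to 1. Their limit vanishes at \<open>q1\<close>, so
  by Hurwitz it is constant, hence zero.\<close>

lemma zero_curve_if_minimal:
  assumes z: "(q1, z1) \<in> theta_zeros" and r: "r > 0" "cball q1 r \<subseteq> ball 0 1 - {0}" and s: "0 < s" "s \<le> 1"
    and nz: "\<And>q x. q \<in> ball q1 r \<Longrightarrow> 1 - s \<le> x \<Longrightarrow> x < 1 \<Longrightarrow>
      partial_theta q (of_real x * (z1 * q1 ^ k / q ^ k)) \<noteq> 0"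
  shows "\<And>q. q \<in> ball q1 r \<Longrightarrow> partial_theta q (z1 * q1 ^ k / q ^ k) = 0"
proof -
  let ?S = "ball q1 r"
  define G where "G x q = partial_theta q (of_real x * (z1 * q1 ^ k / q ^ k))" for x :: real and q
  define y where "y n = 1 - s / real (Suc n)" for n
  have sub: "q \<noteq> 0" "norm q < 1" if "q \<in> cball q1 r" for q
  proof -
    have "q \<in> ball 0 1 - {0}" using that r(2) by blast
    then show "q \<noteq> 0" "norm q < 1" by auto
  qed
  have hol: "G x holomorphic_on ?S" for x
    unfolding G_def by (intro holomorphic_on_theta_comp holomorphic_intros) (use sub in auto)
  have y: "1 - s \<le> y n" "y n < 1" "0 \<le> y n" "y n \<le> 1" for n
    using s unfolding y_def by (auto simp: field_simps intro: order_trans[OF s(2)])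
  have ylim: "y \<longlonglongrightarrow> 1"
  proof -
    have "(\<lambda>n. 1 - s * inverse (real (Suc n))) \<longlonglongrightarrow> 1 - s * 0"
      by (intro tendsto_intros LIMSEQ_inverse_real_of_nat)
    then show ?thesis by (simp add: y_def[abs_def] field_simps)
  qed
  have ul: "uniform_limit K (\<lambda>n. G (y n)) (G 1) sequentially" if K: "compact K" "K \<subseteq> ?S" for K
  proof (rule uniform_limitI)
    fix e :: real assume e: "e > 0"
    have K': "q \<noteq> 0" "norm q < 1" if "q \<in> K" for q using that K sub[of q] by auto
    have "continuous_on ({0..1} \<times> K) (\<lambda>p. G (fst p) (snd p))"
      unfolding G_def by (intro continuous_on_theta_comp continuous_intros) (use K' in auto)
    then have "uniformly_continuous_on ({0..1} \<times> K) (\<lambda>p. G (fst p) (snd p))"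
      using K by (intro compact_uniformly_continuous compact_Times) auto
    then obtain d where d: "d > 0"
      "\<And>p p'. p \<in> {0..1} \<times> K \<Longrightarrow> p' \<in> {0..1} \<times> K \<Longrightarrow> dist p' p < d \<Longrightarrow>
        dist (G (fst p') (snd p')) (G (fst p) (snd p)) < e"
      using e unfolding uniformly_continuous_on_def by metis
    have "\<forall>\<^sub>F n in sequentially. dist (y n) 1 < d"
      using ylim d(1) by (rule tendstoD)
    then show "\<forall>\<^sub>F n in sequentially. \<forall>q\<in>K. dist (G (y n) q) (G 1 q) < e"
    proof eventually_elim
      case (elim n)
      show ?case
      proof
        fix q assume "q \<in> K"
        then show "dist (G (y n) q) (G 1 q) < e"
          using d(2)[of "(1, q)" "(y n, q)"] elim y[of n] by (simp add: dist_Pair_Pair)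
      qed
    qed
  qed
  have q1: "q1 \<in> ?S" using r by simp
  have G1: "G 1 q1 = 0"
    using z sub[of q1] r by (simp add: G_def theta_zeros_iff)
  have "G 1 constant_on ?S"
  proof (rule ccontr)
    assume nc: "\<not> G 1 constant_on ?S"
    have "G 1 q1 \<noteq> 0"
    proof (rule Hurwitz_no_zeros[OF open_ball connected_ball hol hol ul nc _ q1])
      show "G (y n) q \<noteq> 0" if "q \<in> ?S" for n q
        unfolding G_def using that y by (intro nz) auto
    qed
    then show False using G1 by simp
  qed
  then have "G 1 q = 0" if "q \<in> ?S" for q
    using that q1 G1 by (metis constant_on_def)
  then show "\<And>q. q \<in> ball q1 r \<Longrightarrow> partial_theta q (z1 * q1 ^ k / q ^ k) = 0"
    by (simp add: G_def)
qed

text \<open>If \<open>A\<close> met no small q, sublevel sets of |z| |q|^k in \<open>A\<close> over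
  |q| \<le> rho would be compact. Near a minimum, zeros on slightly shrunken curves lie neither in
  \<open>A\<close> (smaller value) nor in \<open>B\<close> (closed and not containing the minimum),
  so there are none, and the curve itself leads \<open>A\<close> to small q.\<close>

lemma separation_reaches_small_q:
  assumes sep: "theta_separation A B" and ne: "A \<inter> theta_zeros \<noteq> {}"
  shows "\<exists>q z. (q, z) \<in> A \<inter> theta_zeros \<and> norm q < 1/100"
proof (rule ccontr)
  assume contra: "\<not> ?thesis"
  then have nosmall: "1/100 \<le> norm q" if "(q, z) \<in> A" "(q, z) \<in> theta_zeros" for q z
    using that by (meson IntI not_le)
  obtain q0 z0 where 0: "(q0, z0) \<in> A" "(q0, z0) \<in> theta_zeros" using ne by auto
  have q0: "0 < norm q0" "norm q0 < 1"
    using nosmall[OF 0] 0 by (auto simp: theta_zeros_iff)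
  \<comment> \<open>Zeros on |q| = rho have |z| |q|^k \<ge> rho^k / 2; k is chosen so that (q0, z0)
    has a smaller value, which keeps the minimum off that circle.\<close>
  define \<rho> where "\<rho> = (1 + norm q0) / 2"
  have \<rho>: "norm q0 < \<rho>" "\<rho> < 1" "0 < \<rho>" using q0 by (auto simp: \<rho>_def add_pos_nonneg)
  have "(\<lambda>k. 2 * norm z0 * (norm q0 / \<rho>) ^ k) \<longlonglongrightarrow> 2 * norm z0 * 0"
    using \<rho> by (intro tendsto_intros LIMSEQ_power_zero) (simp add: abs_of_pos)
  then have "eventually (\<lambda>k. 2 * norm z0 * (norm q0 / \<rho>) ^ k < 1) sequentially"
    by (intro order_tendstoD) auto
  then obtain k where "2 * norm z0 * (norm q0 / \<rho>) ^ k < 1"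
    by (auto simp: eventually_sequentially)
  then have k: "2 * (norm z0 * norm q0 ^ k) < \<rho> ^ k"
    using \<rho> by (simp add: power_divide field_simps)
  define c where "c = norm z0 * norm q0 ^ k"
  define f :: "complex \<times> complex \<Rightarrow> real" where "f x = norm (snd x) * norm (fst x) ^ k" for x
  \<comment> \<open>The bounds |q| \<ge> 1/100 and |z| |q|^k \<le> c give |z| \<le> c 100^k.\<close>
  define Box :: "(complex \<times> complex) set" where "Box = cball 0 \<rho> \<times> cball 0 (c * 100 ^ k)"
  define K where "K = {x \<in> A \<inter> theta_zeros. norm (fst x) \<le> \<rho> \<and> f x \<le> c}"
  have Box: "compact Box" "Box \<subseteq> theta_domain"
    using \<rho> by (auto simp: Box_def theta_domain_def intro: compact_Times)
  have K_eq: "K = A \<inter> {x \<in> Box. (\<lambda>(q, z). partial_theta q z) x = 0} \<inter> {x. f x \<le> c}"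
  proof (intro equalityI subsetI)
    fix x assume x: "x \<in> K"
    obtain q z where qz: "x = (q, z)" by (cases x)
    have q: "1/100 \<le> norm q" using nosmall[of q z] x by (auto simp: K_def qz)
    have "norm z * (1/100) ^ k \<le> norm z * norm q ^ k"
      using q by (intro mult_left_mono power_mono) auto
    also have "\<dots> \<le> c" using x by (simp add: K_def f_def qz)
    finally have "norm z \<le> c * 100 ^ k" by (simp add: power_divide field_simps)
    then show "x \<in> A \<inter> {x \<in> Box. (\<lambda>(q, z). partial_theta q z) x = 0} \<inter> {x. f x \<le> c}"
      using x by (auto simp: K_def Box_def qz theta_zeros_iff)
  next
    fix x assume "x \<in> A \<inter> {x \<in> Box. (\<lambda>(q, z). partial_theta q z) x = 0} \<inter> {x. f x \<le> c}"
    then show "x \<in> K" using Box(2)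
      by (auto simp: K_def Box_def theta_zeros_iff theta_domain_def)
  qed
  have "closed {x \<in> Box. (\<lambda>(q, z). partial_theta q z) x = 0}"
    using Box continuous_on_subset[OF continuous_on_theta Box(2)]
    by (intro continuous_closed_preimage_constant compact_imp_closed)
  moreover have "closed {x. f x \<le> c}"
    unfolding f_def by (intro closed_Collect_le continuous_intros)
  moreover have "closed A" using sep by (simp add: theta_separation_def)
  ultimately have "closed K" unfolding K_eq by (intro closed_Int)
  moreover have "K \<subseteq> Box" by (auto simp: K_eq)
  ultimately have cK: "compact K"
    using Box(1) compact_Int_closed[of Box K] by (simp add: Int_absorb1)
  have "(q0, z0) \<in> K" using 0 \<rho> by (simp add: K_def f_def c_def)
  then have neK: "K \<noteq> {}" by blast
  have "continuous_on K f" unfolding f_def by (intro continuous_intros)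
  from continuous_attains_inf[OF cK neK this]
  obtain x1 where x1: "x1 \<in> K" "\<And>x. x \<in> K \<Longrightarrow> f x1 \<le> f x"
    by blast
  obtain q1 z1 where qz1: "x1 = (q1, z1)" by (cases x1)
  have A1: "(q1, z1) \<in> A" "(q1, z1) \<in> theta_zeros" and f1: "f (q1, z1) \<le> c" "norm q1 \<le> \<rho>"
    using x1(1) by (auto simp: K_def qz1)
  have min: "f (q1, z1) \<le> f x" if "x \<in> A" "x \<in> theta_zeros" "norm (fst x) \<le> \<rho>" for x
    using x1(2)[of x] that f1 by (cases "f x \<le> c") (auto simp: K_def qz1)
  have z1: "1/2 \<le> norm z1" using theta_zero_norm_ge[OF A1(2)] .
  have q1: "1/100 \<le> norm q1" using nosmall[OF A1] .
  have "norm q1 \<noteq> \<rho>"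
  proof
    assume "norm q1 = \<rho>"
    then have "1/2 * \<rho> ^ k \<le> f (q1, z1)"
      unfolding f_def using z1 \<rho> by (auto intro!: mult_right_mono)
    then show False using f1 k by (simp add: c_def)
  qed
  with f1 have q1\<rho>: "norm q1 < \<rho>" by simp
  \<comment> \<open>An open neighbourhood of (1, q1) of parameters (x, q) for which the point over q
    of the curve shrunk by x avoids \<open>B\<close>, while q stays in the punctured disc of radius
    rho.\<close>
  define W where "W = {p :: real \<times> complex. snd p \<noteq> 0 \<and> norm (snd p) < \<rho>} \<inter>
     {p. snd p \<noteq> 0} \<inter> (\<lambda>p. (snd p, of_real (fst p) * (z1 * q1 ^ k / snd p ^ k))) -` (- B)"
  have oB: "open (- B)" using sep by (simp add: theta_separation_def open_Compl)
  have op0: "open {p :: real \<times> complex. snd p \<noteq> 0}"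
    by (intro open_Collect_neq continuous_intros)
  have "open ({p. snd p \<noteq> 0} \<inter> (\<lambda>p. (snd p, of_real (fst p) * (z1 * q1 ^ k / snd p ^ k))) -` (- B))"
    by (rule continuous_open_preimage[OF _ op0 oB]) (intro continuous_intros, auto)
  moreover have "open {p :: real \<times> complex. snd p \<noteq> 0 \<and> norm (snd p) < \<rho>}"
    by (intro open_Collect_conj op0 open_Collect_less continuous_intros)
  ultimately have oW: "open W" unfolding W_def by (simp add: open_Int Int_assoc)
  have "(q1, z1) \<notin> B" using A1 sep by (auto simp: theta_separation_def)
  moreover have "q1 \<noteq> 0" using q1 by auto
  ultimately have "(1, q1) \<in> W" using q1\<rho> by (simp add: W_def)
  then obtain U V where UV: "open U" "open V" "1 \<in> U" "q1 \<in> V" "U \<times> V \<subseteq> W"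
    using open_prod_elim[OF oW] by (metis mem_Sigma_iff)
  obtain s0 where s0: "s0 > 0" "cball 1 s0 \<subseteq> U" using UV open_contains_cball by metis
  obtain r where r: "r > 0" "cball q1 r \<subseteq> V" using UV open_contains_cball by metis
  define s where "s = min s0 1"
  have inW: "(x, q) \<in> W" if "1 - s \<le> x" "x \<le> 1" "q \<in> cball q1 r" for x q
  proof -
    have "x \<in> cball 1 s0" using that by (auto simp: s_def dist_real_def)
    then show ?thesis using that s0 r UV by blast
  qed
  have sub: "cball q1 r \<subseteq> ball 0 1 - {0}"
  proof
    fix q assume "q \<in> cball q1 r"
    then have "(1, q) \<in> W" using s0 by (intro inW) (auto simp: s_def)
    then show "q \<in> ball 0 1 - {0}" using \<rho> by (auto simp: W_def)
  qed
  have "partial_theta q (z1 * q1 ^ k / q ^ k) = 0" if "q \<in> ball q1 r" for q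
  proof (rule zero_curve_if_minimal[OF A1(2) r(1) sub _ _ _ that])
    show "0 < s" "s \<le> 1" using s0 by (auto simp: s_def)
    fix q x assume q: "q \<in> ball q1 r" and x: "1 - s \<le> x" "x < 1"
    let ?z = "of_real x * (z1 * q1 ^ k / q ^ k)"
    show "partial_theta q ?z \<noteq> 0"
    proof
      assume "partial_theta q ?z = 0"
      moreover have W: "(x, q) \<in> W" using q x by (intro inW) auto
      ultimately have "(q, ?z) \<in> theta_zeros" "(q, ?z) \<notin> B" "q \<noteq> 0" "norm q \<le> \<rho>"
        using \<rho> by (auto simp: W_def theta_zeros_iff)
      then have "f (q1, z1) \<le> f (q, ?z)"
        using sep by (intro min) (auto simp: theta_separation_def)
      also have "\<dots> = x * f (q1, z1)"
        using \<open>q \<noteq> 0\<close> x by (simp add: f_def norm_mult norm_divide norm_power s_def)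
      finally have "(1 - x) * f (q1, z1) \<le> 0" by (simp add: algebra_simps)
      moreover have "f (q1, z1) > 0"
        unfolding f_def using z1 \<open>q1 \<noteq> 0\<close> by (intro mult_pos_pos) auto
      ultimately show False using x by (simp add: mult_le_0_iff)
    qed
  qed
  then show False
    using zero_curve_reaches_small_q[OF sep, of q1 z1 r k] A1 r sub contra
    by (meson IntI ball_subset_cball order_trans)
qed

section \<open>Real arguments\<close>

definition real_theta :: "real \<Rightarrow> real \<Rightarrow> real" where
  "real_theta q x = (\<Sum>j. q ^ tri j * x ^ j)"

lemma partial_theta_of_real:
  assumes "\<bar>q\<bar> < 1"
  shows "partial_theta (of_real q) (of_real x) = of_real (real_theta q x)"
proof -
  have "summable (\<lambda>j. q ^ tri j * x ^ j)" using assms by (intro summable_theta) auto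
  from suminf_of_real[OF this, where 'a = complex] show ?thesis
    by (simp add: partial_theta_tri real_theta_def)
qed

lemma real_theta_split:
  assumes "\<bar>q\<bar> < 1"
  shows "real_theta q x = (\<Sum>j<k. q ^ tri j * x ^ j) + x ^ k * q ^ tri k * real_theta q (q ^ k * x)"
proof -
  have "complex_of_real (real_theta q x) =
      of_real ((\<Sum>j<k. q ^ tri j * x ^ j) + x ^ k * q ^ tri k * real_theta q (q ^ k * x))"
    using partial_theta_split[of "of_real q" "of_real x" k] assms
    by (simp add: partial_theta_of_real[OF assms, symmetric])
  then show ?thesis by (simp only: of_real_eq_iff)
qed

lemma real_theta_rec:
  assumes "\<bar>q\<bar> < 1"
  shows "real_theta q x = 1 + q * x * real_theta q (q * x)"
  using real_theta_split[OF assms, of x 1] by (simp add: tri_def mult_ac)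

text \<open>Iteration gives g x \<le> c^n |C| for every n. This is how the functional equation
  yields inequalities: g is the defect of the desired inequality, y the rescaled argument.\<close>

lemma nonpos_by_contraction:
  fixes g :: "'a \<Rightarrow> real"
  assumes bound: "\<And>x. x \<in> S \<Longrightarrow> g x \<le> C" and c: "0 \<le> c" "c < 1"
    and contract: "\<And>x. x \<in> S \<Longrightarrow> \<exists>y\<in>S. \<exists>a. 0 \<le> a \<and> a \<le> c \<and> g x \<le> a * g y"
    and x: "x \<in> S"
  shows "g x \<le> 0"
proof -
  have *: "g x \<le> c ^ n * \<bar>C\<bar>" if "x \<in> S" for n x
    using that
  proof (induction n arbitrary: x)
    case 0
    then show ?case using bound[of x] by simp
  next
    case (Suc n)
    obtain y a where ya: "y \<in> S" "0 \<le> a" "a \<le> c" "g x \<le> a * g y"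
      using contract[OF Suc.prems] by blast
    have "a * g y \<le> a * (c ^ n * \<bar>C\<bar>)" using Suc.IH[OF ya(1)] ya by (intro mult_left_mono) auto
    also have "\<dots> \<le> c * (c ^ n * \<bar>C\<bar>)" using ya c by (intro mult_right_mono) auto
    finally show ?case using ya by simp
  qed
  have "(\<lambda>n. c ^ n * \<bar>C\<bar>) \<longlonglongrightarrow> 0 * \<bar>C\<bar>"
    using c by (intro tendsto_intros LIMSEQ_power_zero) auto
  then show ?thesis
    using *[OF x] by (intro LIMSEQ_le_const) auto
qed

lemma alternating_sum_ge:
  fixes a :: "nat \<Rightarrow> real"
  assumes "\<And>j. j < 2 * m \<Longrightarrow> lo \<le> a j" "\<And>j. j < 2 * m \<Longrightarrow> a j \<le> hi"
  shows "real m * (lo - hi) \<le> (\<Sum>j<2 * m. (- 1) ^ j * a j)"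
  using assms
proof (induction m)
  case (Suc m)
  have "real m * (lo - hi) \<le> (\<Sum>j<2 * m. (- 1) ^ j * a j)"
    using Suc.prems by (intro Suc.IH) auto
  moreover have "lo \<le> a (2 * m)" "a (2 * m + 1) \<le> hi" using Suc.prems by auto
  ultimately show ?case by (simp add: algebra_simps)
qed simp

section \<open>The function theta(p, -y) for 0 < p < 1 and y \<ge> 0\<close>

context
  fixes p :: real
  assumes p: "0 < p" "p < 1"
begin

abbreviation \<phi> :: "real \<Rightarrow> real" where "\<phi> y \<equiv> real_theta p (- y)"

lemma phi_rec: "\<phi> y = 1 - p * y * \<phi> (p * y)"
  using real_theta_rec[of p "- y"] p by simp

text \<open>Two steps, so that the rescaled value has a nonnegative coefficient and inequalities
  keep their direction.\<close>

lemma phi_rec2: "\<phi> y = 1 - p * y + p ^ 3 * y\<^sup>2 * \<phi> (p\<^sup>2 * y)"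
proof -
  have "\<phi> y = 1 - p * y * (1 - p * (p * y) * \<phi> (p * (p * y)))"
    by (metis phi_rec)
  then show ?thesis by (simp add: algebra_simps power2_eq_square power3_eq_cube)
qed

lemma phi_bounded: "\<exists>C. \<forall>y\<in>{0..1}. \<bar>\<phi> y\<bar> \<le> C"
proof (intro exI ballI)
  fix y :: real assume y: "y \<in> {0..1}"
  have "\<bar>\<phi> y\<bar> \<le> (\<Sum>j. \<bar>p ^ tri j * (- y) ^ j\<bar>)"
    unfolding real_theta_def using summable_norm[OF summable_norm_theta[of p "- y"]] p by simp
  also have "\<dots> \<le> (\<Sum>j. p ^ tri j * 1 ^ j)"
  proof (rule suminf_le)
    show "\<bar>p ^ tri j * (- y) ^ j\<bar> \<le> p ^ tri j * 1 ^ j" for j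
      using p y by (auto simp: abs_mult power_abs power_le_one intro!: mult_left_le)
    show "summable (\<lambda>j. \<bar>p ^ tri j * (- y) ^ j\<bar>)"
      using summable_norm_theta[of p "- y"] p by simp
    show "summable (\<lambda>j. p ^ tri j * 1 ^ j)"
      using p by (intro summable_theta_majorant) auto
  qed
  finally show "\<bar>\<phi> y\<bar> \<le> (\<Sum>j. p ^ tri j * 1 ^ j)" .
qed

text \<open>1 / (1 + p y) is a supersolution of the two-step recursion on [0, 1], so the defect
  contracts with factor p^3 y^2 \<le> p. The supersolution property reduces to (1 - p) (1 - p^2 y)
  \<ge> 0.\<close>

lemma phi_le:
  assumes "0 \<le> y" "y \<le> 1"
  shows "\<phi> y \<le> 1 / (1 + p * y)"
proof -
  obtain C where C: "\<And>y. y \<in> {0..1} \<Longrightarrow> \<bar>\<phi> y\<bar> \<le> C" using phi_bounded by blast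
  have "\<phi> y - 1 / (1 + p * y) \<le> 0"
  proof (rule nonpos_by_contraction[where S = "{0..1}" and c = p and C = C and g = "\<lambda>y. \<phi> y - 1 / (1 + p * y)"])
    fix y :: real assume y: "y \<in> {0..1}"
    show "\<phi> y - 1 / (1 + p * y) \<le> C"
    proof -
      have "0 \<le> 1 / (1 + p * y)" using p y by auto
      then show ?thesis using C[OF y] by linarith
    qed
    have p2y: "p\<^sup>2 * y \<in> {0..1}"
      using y p by (auto intro!: mult_le_one power_le_one)
    have "1 - p * y + p ^ 3 * y\<^sup>2 * (1 / (1 + p * (p\<^sup>2 * y))) \<le> 1 / (1 + p * y)"
    proof -
      have A: "0 < 1 + p * y" and B: "0 < 1 + p ^ 3 * y" using p y by (auto intro!: add_pos_nonneg)
      have "0 \<le> (1 - p) * (1 - p\<^sup>2 * y)" using p2y p by auto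
      then have "p * (1 + p * y) \<le> 1 + p ^ 3 * y"
        by (simp add: algebra_simps power2_eq_square power3_eq_cube)
      then have "p * y\<^sup>2 * p\<^sup>2 * (1 + p * y) \<le> y\<^sup>2 * p\<^sup>2 * (1 + p ^ 3 * y)"
        using mult_left_mono[of "p * (1 + p * y)" "1 + p ^ 3 * y" "y\<^sup>2 * p\<^sup>2"] by (simp add: mult_ac)
      then have "p ^ 3 * y\<^sup>2 / (1 + p ^ 3 * y) \<le> y\<^sup>2 * p\<^sup>2 / (1 + p * y)"
        using A B by (intro mult_imp_div_pos_le) (simp_all add: pos_le_divide_eq power3_eq_cube power2_eq_square mult_ac)
      moreover have "1 - p * y + y\<^sup>2 * p\<^sup>2 / (1 + p * y) = 1 / (1 + p * y)"
      proof -
        have "1 - p * y + y\<^sup>2 * p\<^sup>2 / (1 + p * y) = ((1 - p * y) * (1 + p * y) + y\<^sup>2 * p\<^sup>2) / (1 + p * y)"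
          using A by (subst add_divide_distrib) simp
        also have "(1 - p * y) * (1 + p * y) + y\<^sup>2 * p\<^sup>2 = 1"
          by (simp add: algebra_simps power2_eq_square)
        finally show ?thesis .
      qed
      ultimately show ?thesis by (simp add: power3_eq_cube power2_eq_square mult_ac)
    qed
    then have "\<phi> y - 1 / (1 + p * y) \<le> (p ^ 3 * y\<^sup>2) * (\<phi> (p\<^sup>2 * y) - 1 / (1 + p * (p\<^sup>2 * y)))"
      by (subst phi_rec2) (simp add: algebra_simps)
    moreover have "p ^ 3 * y\<^sup>2 \<le> p * 1"
      using p y power_decreasing[of 1 3 p] by (intro mult_mono) (auto intro: power_le_one)
    ultimately show "\<exists>z\<in>{0..1}. \<exists>a. 0 \<le> a \<and> a \<le> p \<and>
       \<phi> y - 1 / (1 + p * y) \<le> a * (\<phi> z - 1 / (1 + p * z))"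
      using p2y p by (intro bexI[of _ "p\<^sup>2 * y"] exI[of _ "p ^ 3 * y\<^sup>2"]) auto
  qed (use p assms in auto)
  then show ?thesis by simp
qed

text \<open>One further step of the recursion turns the upper bound of \<open>phi_le\<close> into
  the lower bound 1 - p y / (1 + p^2 y), which exceeds 1/2 exactly when 2 p y < 1 + p^2 y.\<close>

lemma phi_gt_half:
  assumes "0 \<le> y" "y \<le> 1"
  shows "1/2 < \<phi> y"
proof -
  have py: "0 \<le> p * y" "p * y \<le> 1" using assms p by (auto intro: mult_le_one)
  \<comment> \<open>The right-hand side is 1 + p^2 y - 2 p y.\<close>
  have "0 < (1 - p)\<^sup>2 + (2 * p - p\<^sup>2) * (1 - y)"
  proof (rule add_pos_nonneg)
    have "p * p \<le> p * 1" using p by (intro mult_left_mono) auto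
    then show "0 \<le> (2 * p - p\<^sup>2) * (1 - y)" using p assms by (auto simp: power2_eq_square)
  qed (use p in auto)
  then have "2 * (p * y) < 1 + p * (p * y)" by (simp add: algebra_simps power2_eq_square)
  then have "p * y * (1 / (1 + p * (p * y))) < 1/2"
    using p py by (simp add: field_simps add_pos_nonneg)
  moreover have "p * y * \<phi> (p * y) \<le> p * y * (1 / (1 + p * (p * y)))"
    using phi_le[OF py] py by (intro mult_left_mono) auto
  ultimately show ?thesis by (subst phi_rec) linarith
qed

text \<open>Prepared for 0 \<le> x < y \<le> 1: \<open>phi_gt_half\<close> makes the first summand
  positive, and the second is the same increment at rescaled arguments with a nonnegative
  factor.\<close>

lemma phi_increment:
  "y * \<phi> y - x * \<phi> x = (y - x) * (\<phi> y + \<phi> x - 1) +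
     p * y * x * (p\<^sup>2 * y * \<phi> (p\<^sup>2 * y) - p\<^sup>2 * x * \<phi> (p\<^sup>2 * x))"
proof -
  have 1: "\<phi> y = 1 - p * y * \<phi> (p * y)" "\<phi> x = 1 - p * x * \<phi> (p * x)" by (rule phi_rec)+
  have 2: "\<phi> (p * y) = 1 - p\<^sup>2 * y * \<phi> (p\<^sup>2 * y)" "\<phi> (p * x) = 1 - p\<^sup>2 * x * \<phi> (p\<^sup>2 * x)"
    using phi_rec[of "p * y"] phi_rec[of "p * x"] by (simp_all add: power2_eq_square mult_ac)
  define a b where "a = \<phi> (p\<^sup>2 * y)" and "b = \<phi> (p\<^sup>2 * x)"
  show ?thesis unfolding 1 2 a_def[symmetric] b_def[symmetric] using p
    by (simp add: algebra_simps)
qed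

text \<open>\<open>nonpos_by_contraction\<close> on ordered pairs gives the weak inequality;
  inserted once more into \<open>phi_increment\<close> it becomes strict.\<close>

lemma mult_phi_strict_mono:
  assumes "0 \<le> x" "x < y" "y \<le> 1"
  shows "x * \<phi> x < y * \<phi> y"
proof -
  obtain C where C: "\<And>y. y \<in> {0..1} \<Longrightarrow> \<bar>\<phi> y\<bar> \<le> C" using phi_bounded by blast
  define S where "S = {(y, x). 0 \<le> x \<and> x \<le> y \<and> y \<le> (1::real)}"
  define g where "g = (\<lambda>(y, x). x * \<phi> x - y * \<phi> y)"
  have eq: "g (y, x) = p * y * x * g (p\<^sup>2 * y, p\<^sup>2 * x) - (y - x) * (\<phi> y + \<phi> x - 1)" for x y
    using phi_increment[of y x] p by (simp add: g_def algebra_simps)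
  have le0: "g s \<le> 0" if "s \<in> S" for s
  proof (rule nonpos_by_contraction[where S = S and c = p and C = "2 * C" and g = g])
    show "s \<in> S" by fact
    fix s assume "s \<in> S"
    then obtain y x where s: "s = (y, x)" "0 \<le> x" "x \<le> y" "y \<le> 1" by (auto simp: S_def)
    have "\<bar>x * \<phi> x\<bar> \<le> 1 * C" "\<bar>y * \<phi> y\<bar> \<le> 1 * C"
      unfolding abs_mult using s C[of x] C[of y] by (intro mult_mono; simp)+
    then show "g s \<le> 2 * C" by (simp add: g_def s)
    have "(p\<^sup>2 * y, p\<^sup>2 * x) \<in> S"
      using s p by (auto simp: S_def intro!: mult_left_mono mult_le_one power_le_one)
    moreover have "0 \<le> (y - x) * (\<phi> y + \<phi> x - 1)"
      using s phi_gt_half[of x] phi_gt_half[of y] by (intro mult_nonneg_nonneg) auto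
    then have "g s \<le> (p * y * x) * g (p\<^sup>2 * y, p\<^sup>2 * x)" using eq[of y x] unfolding s by linarith
    moreover have "p * y * x \<le> p * 1 * 1" using s p by (intro mult_mono) auto
    ultimately show "\<exists>t\<in>S. \<exists>a. 0 \<le> a \<and> a \<le> p \<and> g s \<le> a * g t"
      using s p by (intro bexI[of _ "(p\<^sup>2 * y, p\<^sup>2 * x)"] exI[of _ "p * y * x"]) auto
  qed (use p in auto)
  have "(p\<^sup>2 * y, p\<^sup>2 * x) \<in> S"
    using assms p by (auto simp: S_def intro!: mult_left_mono mult_le_one power_le_one)
  then have "p * y * x * g (p\<^sup>2 * y, p\<^sup>2 * x) \<le> 0"
    using le0 assms p by (intro mult_nonneg_nonpos) auto
  moreover have "0 < (y - x) * (\<phi> y + \<phi> x - 1)"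
    using assms phi_gt_half[of x] phi_gt_half[of y] by (intro mult_pos_pos) auto
  ultimately show ?thesis using eq[of y x] by (simp add: g_def)
qed

text \<open>\<open>phi_rec\<close> subtracts from 1 the increasing function of
  \<open>mult_phi_strict_mono\<close> taken at p y, which extends the range to 1 / p.\<close>

lemma phi_strict_antimono:
  assumes "0 \<le> x" "x < y" "y \<le> 1 / p"
  shows "\<phi> y < \<phi> x"
proof -
  have "(p * x) * \<phi> (p * x) < (p * y) * \<phi> (p * y)"
    using assms p by (intro mult_phi_strict_mono) (auto simp: field_simps)
  then show ?thesis using phi_rec[of x] phi_rec[of y] by linarith
qed

text \<open>E = 4 m^2 bounds \<open>tri j\<close> for j \<le> 2 m as well as the exponent of 1 / p
  in y^j, so these terms have absolute values in [p^E, p^(-E)]. Pairing neighbours leaves a lower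
  bound that tends to 0 as p tends to 1; the tail, an even power times a value above 1/2,
  contributes at least p^E / 2.\<close>

lemma phi_ge:
  assumes y: "1 \<le> y" "y \<le> 1 / p ^ (2 * m)" and m: "m > 0"
  shows "real m * (p ^ (4 * m\<^sup>2) - 1 / p ^ (4 * m\<^sup>2)) + p ^ (4 * m\<^sup>2) / 2 \<le> \<phi> y"
proof -
  let ?E = "4 * m\<^sup>2"
  let ?a = "\<lambda>j. p ^ tri j * y ^ j"
  have tri: "tri j \<le> ?E" if "j \<le> 2 * m" for j
  proof -
    have "j * (j + 1) \<le> 2 * m * (2 * m + 1)" using that by (intro mult_mono) auto
    also have "\<dots> \<le> 2 * ?E" using m by (simp add: power2_eq_square)
    finally show ?thesis using two_tri[of j] by linarith
  qed
  have lo: "p ^ ?E \<le> ?a j" if "j \<le> 2 * m" for j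
  proof -
    have "p ^ ?E * 1 \<le> p ^ tri j * y ^ j"
      using p y tri[OF that] by (intro mult_mono power_decreasing one_le_power) auto
    then show ?thesis by simp
  qed
  have hi: "?a j \<le> 1 / p ^ ?E" if "j \<le> 2 * m" for j
  proof -
    have "y ^ j \<le> y ^ (2 * m)" using y that by (intro power_increasing) auto
    also have "\<dots> \<le> (1 / p ^ (2 * m)) ^ (2 * m)" using y by (intro power_mono) auto
    also have "\<dots> = 1 / p ^ ?E" by (simp add: power_divide power2_eq_square flip: power_mult)
    finally have "1 * y ^ j \<le> 1 / p ^ ?E" by simp
    moreover have "p ^ tri j * y ^ j \<le> 1 * y ^ j"
      using p y by (intro mult_right_mono power_le_one) auto
    ultimately show ?thesis by linarith
  qed
  have "\<phi> y = (\<Sum>j<2 * m. p ^ tri j * (- y) ^ j) +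
      (- y) ^ (2 * m) * p ^ tri (2 * m) * real_theta p (p ^ (2 * m) * - y)"
    using p by (intro real_theta_split) auto
  also have "(\<Sum>j<2 * m. p ^ tri j * (- y) ^ j) = (\<Sum>j<2 * m. (- 1) ^ j * ?a j)"
    by (rule sum.cong) (auto simp: power_minus[of y])
  also have "(- y) ^ (2 * m) * p ^ tri (2 * m) * real_theta p (p ^ (2 * m) * - y) = ?a (2 * m) * \<phi> (p ^ (2 * m) * y)"
    by simp
  finally have eq: "\<phi> y = (\<Sum>j<2 * m. (- 1) ^ j * ?a j) + ?a (2 * m) * \<phi> (p ^ (2 * m) * y)" .
  have "p ^ (2 * m) * y \<le> 1" using y p by (simp add: field_simps)
  then have "1/2 < \<phi> (p ^ (2 * m) * y)" using p y by (intro phi_gt_half) auto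
  then have "p ^ ?E * (1/2) \<le> ?a (2 * m) * \<phi> (p ^ (2 * m) * y)"
    using lo[of "2 * m"] p y by (intro mult_mono) auto
  moreover have "real m * (p ^ ?E - 1 / p ^ ?E) \<le> (\<Sum>j<2 * m. (- 1) ^ j * ?a j)"
    using lo hi by (intro alternating_sum_ge) auto
  ultimately show ?thesis unfolding eq by linarith
qed

end

lemma phi_pos_near_1:
  assumes "m > 0"
  shows "\<forall>\<^sub>F p in at_left 1. \<forall>y. 0 \<le> y \<and> y \<le> 1 / p ^ (2 * m) \<longrightarrow> 0 < real_theta p (- y)"
proof -
  let ?E = "4 * m\<^sup>2"
  have "((\<lambda>p::real. real m * (p ^ ?E - 1 / p ^ ?E) + p ^ ?E / 2) \<longlongrightarrow>
      real m * (1 ^ ?E - 1 / 1 ^ ?E) + 1 ^ ?E / 2) (at_left 1)"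
    by (intro tendsto_intros) auto
  then have "\<forall>\<^sub>F p in at_left 1. 0 < real m * (p ^ ?E - 1 / p ^ ?E) + p ^ ?E / 2"
    by (rule order_tendstoD) simp
  moreover have "\<forall>\<^sub>F p in at_left (1::real). p \<in> {0<..<1}"
    by (rule eventually_at_leftI[of 0]) auto
  ultimately show ?thesis
  proof eventually_elim
    case (elim p)
    show ?case
    proof (intro allI impI)
      fix y assume y: "0 \<le> y \<and> y \<le> 1 / p ^ (2 * m)"
      show "0 < real_theta p (- y)"
      proof (cases "y \<le> 1")
        case True
        then show ?thesis using phi_gt_half[of p y] y elim by simp
      next
        case False
        then show ?thesis using phi_ge[of p y m] y elim assms by simp
      qed
    qed
  qed
qed

text \<open>Split by parity: tri (2 m) = 4 tri m - m and tri (2 m + 1) = 4 tri m + m + 1, so both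
  halves are theta series with base p^4. The signs +, -, -, + of (-p)^(tri n) alternate within each
  half, which makes both arguments negative.\<close>

lemma real_theta_neg_bisect:
  assumes p: "0 < p" "p < 1"
  shows "real_theta (- p) x = real_theta (p ^ 4) (- (x\<^sup>2 / p)) - p * x * real_theta (p ^ 4) (- (p * x\<^sup>2))"
proof -
  have p4: "\<bar>p ^ 4\<bar> < 1" using p by (simp add: power_less_one_iff abs_of_pos)
  define f where "f m = (p ^ 4) ^ tri m * (- (x\<^sup>2 / p)) ^ m" for m
  define g where "g m = - (p * x) * ((p ^ 4) ^ tri m * (- (p * x\<^sup>2)) ^ m)" for m
  have t2: "tri (2 * m) = m * (2 * m + 1)" "tri (2 * m + 1) = (2 * m + 1) * (m + 1)" for m
    using two_tri[of "2 * m"] two_tri[of "2 * m + 1"] by auto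
  have f: "f m = (- p) ^ tri (2 * m) * x ^ (2 * m)" for m
  proof -
    have "(p ^ 4) ^ tri m = p ^ (2 * (m * (m + 1)))"
      unfolding power_mult[symmetric] two_tri[symmetric] by simp
    also have "2 * (m * (m + 1)) = m * (2 * m + 1) + m" by (simp add: algebra_simps)
    finally have P: "(p ^ 4) ^ tri m = p ^ (m * (2 * m + 1)) * p ^ m" by (simp only: power_add)
    have "(- p) ^ tri (2 * m) = (- 1) ^ m * p ^ (m * (2 * m + 1))"
    proof -
      have "(- 1) ^ (m * (2 * m + 1)) = ((- 1) ^ m :: real)"
        by (subst mult.commute) (simp only: power_mult, simp)
      then show ?thesis unfolding t2 by (subst power_minus) simp
    qed
    moreover have "(- (x\<^sup>2 / p)) ^ m = (- 1) ^ m * x ^ (2 * m) / p ^ m"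
      by (simp add: power_minus[of "x\<^sup>2 / p"] power_divide power_mult)
    ultimately show ?thesis unfolding f_def P using p by simp
  qed
  have g: "g m = (- p) ^ tri (2 * m + 1) * x ^ (2 * m + 1)" for m
  proof -
    have P: "(p ^ 4) ^ tri m = p ^ (2 * (m * (m + 1)))"
      unfolding power_mult[symmetric] two_tri[symmetric] by simp
    have sgn: "(- 1) ^ ((2 * m + 1) * (m + 1)) = ((- 1) ^ (m + 1) :: real)"
      by (simp only: power_mult) simp
    have e: "(2 * m + 1) * (m + 1) = 2 * (m * (m + 1)) + m + 1" by (simp add: algebra_simps)
    have "(- p) ^ tri (2 * m + 1) = (- 1) ^ ((2 * m + 1) * (m + 1)) * p ^ ((2 * m + 1) * (m + 1))"
      unfolding t2 by (rule power_minus)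
    also have "\<dots> = (- 1) ^ (m + 1) * p ^ (2 * (m * (m + 1)) + m + 1)"
      by (subst sgn, subst e, rule refl)
    finally have 1: "(- p) ^ tri (2 * m + 1) = ((- 1) ^ m * (- 1)) * (p ^ (2 * (m * (m + 1))) * p ^ m * p)"
      by (simp only: power_add power_one_right)
    have 2: "(- (p * x\<^sup>2)) ^ m = (- 1) ^ m * (p ^ m * x ^ (2 * m))"
      by (subst power_minus) (simp add: power_mult_distrib power_mult)
    have 3: "x ^ (2 * m + 1) = x ^ (2 * m) * x" by simp
    have "- (p * x) * (Q * (s * (R * X))) = (s * (- 1)) * (Q * R * p) * (X * x)" for Q R X s :: real
      by (simp only: mult_ac mult_minus_left mult_minus_right mult_1_left mult_1_right)
    then show ?thesis unfolding g_def P 1 2 3 .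
  qed
  have fs: "f sums real_theta (p ^ 4) (- (x\<^sup>2 / p))"
    unfolding f_def real_theta_def using p4 by (intro summable_sums summable_theta) auto
  have gs: "g sums (- (p * x) * real_theta (p ^ 4) (- (p * x\<^sup>2)))"
    unfolding g_def real_theta_def using p4 by (intro sums_mult summable_sums summable_theta) auto
  have "(\<lambda>n. if even n then f (n div 2) else g ((n - 1) div 2)) sums
      (- (p * x) * real_theta (p ^ 4) (- (p * x\<^sup>2)) + real_theta (p ^ 4) (- (x\<^sup>2 / p)))"
    by (rule sums_if[OF gs fs])
  also have "(\<lambda>n. if even n then f (n div 2) else g ((n - 1) div 2)) = (\<lambda>n. (- p) ^ tri n * x ^ n)"
  proof
    fix n :: nat
    show "(if even n then f (n div 2) else g ((n - 1) div 2)) = (- p) ^ tri n * x ^ n"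
      by (cases "even n") (auto simp: f g elim!: evenE oddE)
  qed
  finally show ?thesis by (simp add: real_theta_def sums_iff)
qed

text \<open>For t \<ge> -1/4 the main part 1 + t is at least 3/4 and outweighs the rest, at most
  1/10. The window is thus positive, and theta has the sign of q^(tri m) t^m.\<close>

lemma real_theta_shift_pos:
  assumes q: "\<bar>q\<bar> \<le> 1/100" "q \<noteq> 0" and t: "- 1/4 \<le> t" "1/4 \<le> \<bar>t\<bar>" "t \<le> 1"
  shows "0 < q ^ tri m * t ^ m * real_theta q (t / q ^ Suc m)"
proof -
  let ?W = "theta_window m (of_real q) (of_real t)"
  define T where "T = real_theta q (t / q ^ Suc m)"
  have "complex_of_real (q ^ tri m * T) = of_real (t ^ m) * ?W"
    using theta_shift[of "of_real q" "of_real t" m] q t partial_theta_of_real[of q "t / q ^ Suc m"]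
    by (simp add: T_def)
  then have "Re (complex_of_real (q ^ tri m * T)) = Re (of_real (t ^ m) * ?W)" by (rule arg_cong)
  then have eq: "q ^ tri m * T = t ^ m * Re ?W"
    by (simp only: Re_complex_of_real) simp
  have "\<bar>Re (window_rest m (of_real q) (of_real t))\<bar> \<le> 1/10"
    using norm_window_rest_small[of "of_real q" "of_real t" m] q t
    by (intro order_trans[OF abs_Re_le_cmod]) auto
  moreover have "Re ?W = 1 + t + Re (window_rest m (of_real q) (of_real t))"
    by (simp add: window_rest_def)
  ultimately have "0 < Re ?W" using t by linarith
  moreover have "t ^ m \<noteq> 0" using t by auto
  then have "0 < t ^ m * t ^ m" by (metis not_real_square_gt_zero)
  ultimately have "0 < t ^ m * t ^ m * Re ?W" by (rule mult_pos_pos[rotated])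
  also have "\<dots> = q ^ tri m * t ^ m * T" using eq by (simp add: mult_ac)
  finally show ?thesis by (simp add: T_def)
qed

lemma real_theta_reflect:
  assumes "\<bar>q\<bar> < 1" "q \<noteq> 0"
  shows "real_theta q (- 1 / q ^ n) = q ^ n * real_theta q (- (q ^ n))"
proof -
  have "complex_of_real (real_theta q (- 1 / q ^ n)) = of_real (q ^ n * real_theta q (- (q ^ n)))"
    using theta_reflect[of "of_real q" n] assms
      partial_theta_of_real[of q "- 1 / q ^ n"] partial_theta_of_real[of q "- (q ^ n)"] by simp
  then show ?thesis by (simp only: of_real_eq_iff)
qed

lemma even_tri_4: "even (tri (4 * i))"
proof -
  have "tri (4 * i) = 2 * (i * (4 * i + 1))" using two_tri[of "4 * i"] by simp
  then show ?thesis by simp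
qed

section \<open>Signs at the end points, and upper bounds for q = -p and x > 0\<close>

context
  fixes p :: real
  assumes p: "0 < p" "p < 1"
begin

lemma p4: "0 < p ^ 4" "p ^ 4 < 1"
  using p by (auto simp: power_less_one_iff)

lemma real_theta_end_pos: "0 < real_theta p (- (1 / p ^ n))"
proof -
  have "p ^ n \<le> 1" using p by (simp add: power_le_one)
  then have "0 < p ^ n * real_theta p (- (p ^ n))"
    using phi_gt_half[OF p, of "p ^ n"] p by (intro mult_pos_pos) auto
  then show ?thesis using real_theta_reflect[of p n] p by simp
qed

text \<open>After reflection the argument is x = -p^n, where the two halves of
  \<open>real_theta_neg_bisect\<close> add. For n > 0 both inner arguments lie in the range of
  \<open>phi_gt_half\<close>.\<close>

lemma real_theta_neg_end_even:
  assumes "even n" "n > 0"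
  shows "0 < real_theta (- p) (- (1 / p ^ n))"
proof -
  have eq: "(- p) ^ n = p ^ n" using assms by simp
  have n: "p ^ n \<le> p" using power_decreasing[of 1 n p] p assms by simp
  have y1: "(p ^ n)\<^sup>2 / p \<le> 1"
  proof -
    have "(p ^ n)\<^sup>2 \<le> p * 1"
      unfolding power2_eq_square using n p by (intro mult_mono) (auto intro: power_le_one)
    then show ?thesis using p by (simp add: field_simps)
  qed
  have y2: "p * (p ^ n)\<^sup>2 \<le> 1" using p by (intro mult_le_one) (auto intro!: power_le_one)
  have "0 < real_theta (p ^ 4) (- ((p ^ n)\<^sup>2 / p)) + p * p ^ n * real_theta (p ^ 4) (- (p * (p ^ n)\<^sup>2))"
    using phi_gt_half[OF p4, of "(p ^ n)\<^sup>2 / p"] phi_gt_half[OF p4, of "p * (p ^ n)\<^sup>2"] y1 y2 p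
    by (intro add_pos_pos mult_pos_pos) auto
  then have "0 < real_theta (- p) (- (p ^ n))"
    using real_theta_neg_bisect[OF p, of "- (p ^ n)"] by simp
  then show ?thesis
    using real_theta_reflect[of "- p" n] p eq by simp
qed

text \<open>Reflection with odd n leads to x = p^n and brings a minus sign. The two halves now
  compete; with y = p^(2 n - 1) they are compared by \<open>mult_phi_strict_mono\<close> between p^2
  y and y.\<close>

lemma real_theta_neg_end_odd:
  assumes "odd n"
  shows "real_theta (- p) (1 / p ^ n) < 0"
proof -
  have eq: "(- p) ^ n = - (p ^ n)" using assms by simp
  have n1: "n \<ge> 1" using assms by (cases n) auto
  have n: "p ^ n \<le> p" using power_decreasing[of 1 n p] p n1 by simp
  define y where "y = (p ^ n)\<^sup>2 / p"
  have y0: "0 < y" using p by (simp add: y_def)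
  have y1: "y \<le> 1"
  proof -
    have "(p ^ n)\<^sup>2 \<le> p * 1"
      unfolding power2_eq_square using n p by (intro mult_mono) (auto intro: power_le_one)
    then show ?thesis using p by (simp add: field_simps y_def)
  qed
  have y2: "p * (p ^ n)\<^sup>2 = p\<^sup>2 * y" using p by (simp add: y_def power2_eq_square)
  have p2: "p\<^sup>2 < 1" using p by (simp add: power_less_one_iff)
  have y2': "p\<^sup>2 * y < y" "0 \<le> p\<^sup>2 * y" using y0 p2 by auto
  have "p\<^sup>2 * y * real_theta (p ^ 4) (- (p\<^sup>2 * y)) < y * real_theta (p ^ 4) (- y)"
    using y2' y1 by (intro mult_phi_strict_mono[OF p4]) auto
  then have "y * (p\<^sup>2 * real_theta (p ^ 4) (- (p\<^sup>2 * y))) < y * real_theta (p ^ 4) (- y)"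
    by (simp only: mult_ac)
  then have "p\<^sup>2 * real_theta (p ^ 4) (- (p\<^sup>2 * y)) < real_theta (p ^ 4) (- y)"
    using y0 by simp
  moreover have "p * p ^ n * real_theta (p ^ 4) (- (p\<^sup>2 * y)) \<le> p\<^sup>2 * real_theta (p ^ 4) (- (p\<^sup>2 * y))"
    using phi_gt_half[OF p4, of "p\<^sup>2 * y"] y2' y1 n p
    by (intro mult_right_mono) (auto simp: power2_eq_square intro: mult_left_mono)
  ultimately have "0 < real_theta (- p) (p ^ n)"
    unfolding real_theta_neg_bisect[OF p, of "p ^ n"] y2 by (simp add: y_def)
  then have "0 < p ^ n * real_theta (- p) (p ^ n)" using p by simp
  then show ?thesis
    using real_theta_reflect[of "- p" n] p eq by simp
qed

text \<open>The two halves nearly cancel: with f y = theta(p^4, -y) decreasing, f(x^2 / p) is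
  replaced by f(p x^2), which leaves the factor 1 - p x. The power p^7 is p^4 times the least
  argument p^3.\<close>

lemma real_theta_neg_le:
  assumes x: "p \<le> x" "x \<le> 1 / p"
  shows "real_theta (- p) x \<le> (1 - p\<^sup>2) / (1 + p ^ 7)"
proof -
  have px: "p * p \<le> p * x" "p * x \<le> 1" using x p by (auto intro: mult_left_mono simp: field_simps)
  have x2: "p\<^sup>2 \<le> x\<^sup>2" "x\<^sup>2 \<le> (1 / p)\<^sup>2" using x p by (intro power_mono; simp)+
  have lo: "p ^ 3 \<le> p * x\<^sup>2" using x2 p by (simp add: power3_eq_cube power2_eq_square mult.assoc)
  have lt: "p * x\<^sup>2 < x\<^sup>2 / p"
  proof -
    have "p * p < 1 * 1" using p by (intro mult_strict_mono) auto
    then have "(p * p) * x\<^sup>2 < 1 * x\<^sup>2" using x p by (intro mult_strict_right_mono) auto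
    then show ?thesis using p by (simp add: field_simps)
  qed
  have hi: "x\<^sup>2 / p \<le> 1 / p ^ 4"
  proof -
    have "x\<^sup>2 / p \<le> (1 / p)\<^sup>2 / p" using x2 p by (intro divide_right_mono) auto
    also have "\<dots> = 1 / p ^ 3" by (simp add: power2_eq_square power3_eq_cube)
    also have "\<dots> \<le> 1 / p ^ 4" using p by (intro divide_left_mono power_decreasing) auto
    finally show ?thesis .
  qed
  let ?f = "\<lambda>y. real_theta (p ^ 4) (- y)"
  have "?f (x\<^sup>2 / p) < ?f (p * x\<^sup>2)"
    using p lt hi by (intro phi_strict_antimono[OF p4]) auto
  moreover have f2: "?f (p * x\<^sup>2) \<le> ?f (p ^ 3)"
    using phi_strict_antimono[OF p4, of "p ^ 3" "p * x\<^sup>2"] lo lt hi p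
    by (cases "p ^ 3 = p * x\<^sup>2") auto
  moreover have f3: "?f (p ^ 3) \<le> 1 / (1 + p ^ 7)"
    using phi_le[OF p4, of "p ^ 3"] p by (simp add: power_le_one flip: power_add)
  ultimately have "real_theta (- p) x \<le> ?f (p * x\<^sup>2) * (1 - p * x)"
    unfolding real_theta_neg_bisect[OF p, of x] by (simp add: algebra_simps)
  also have "\<dots> \<le> 1 / (1 + p ^ 7) * (1 - p * x)"
    using f2 f3 px by (intro mult_right_mono) auto
  also have "\<dots> \<le> 1 / (1 + p ^ 7) * (1 - p\<^sup>2)"
    using px p by (intro mult_left_mono) (auto simp: power2_eq_square)
  finally show ?thesis by simp
qed

text \<open>The signs are +, -, -, +. The factorisation separates a product of two factors, both of
  order 1 - p when u is a fixed power of 1 / p, from the first-order term - p u^3 (1 - p^2), which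
  decides the sign.\<close>

lemma theta_terms_block:
  defines "f \<equiv> \<lambda>j x. (- p) ^ tri j * x ^ j"
  assumes u: "u = p ^ (4 * i + 1) * x"
  shows "f (4 * i) x + f (4 * i + 1) x + f (4 * i + 2) x + f (4 * i + 3) x =
    p ^ tri (4 * i) * x ^ (4 * i) * ((u - 1) * (p * u\<^sup>2 - 1) - p * u ^ 3 * (1 - p\<^sup>2))"
proof -
  define a where "a = p ^ tri (4 * i) * x ^ (4 * i)"
  have f0: "f (4 * i) x = a" using even_tri_4[of i] by (simp add: f_def a_def)
  have step: "f (Suc j) x = f j x * ((- p) ^ Suc j * x)" for j
    by (simp add: f_def tri_Suc power_add mult_ac)
  have f1: "f (4 * i + 1) x = - a * u"
    using step[of "4 * i"] f0 by (simp add: u mult_ac)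
  have f2: "f (4 * i + 2) x = - a * (p * u\<^sup>2)"
    using step[of "4 * i + 1"] f1 by (simp add: u power2_eq_square mult_ac)
  have f3: "f (4 * i + 3) x = a * (p ^ 3 * u ^ 3)"
    using step[of "4 * i + 2"] f2 by (simp add: u power3_eq_cube power2_eq_square numeral_3_eq_3 mult_ac)
  have e: "1 - u - p * u\<^sup>2 + p ^ 3 * u ^ 3 = (u - 1) * (p * u\<^sup>2 - 1) - p * u ^ 3 * (1 - p\<^sup>2)"
    by (simp add: algebra_simps power2_eq_square power3_eq_cube)
  have "a + - a * u + - a * (p * u\<^sup>2) + a * (p ^ 3 * u ^ 3) = a * (1 - u - p * u\<^sup>2 + p ^ 3 * u ^ 3)"
    by (simp add: algebra_simps)
  then show ?thesis unfolding f0 f1 f2 f3 a_def[symmetric] e .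
qed

text \<open>As \<open>p\<close> tends to 1, the first \<open>4 * k\<close> terms contribute at most about \<open>- 2 * k * (1 - p)\<close>,
  and the remainder at most about \<open>1 - p\<close>.\<close>

lemma real_theta_neg_block_bound:
  fixes k :: nat
  defines "L \<equiv> (4 * k + 1) * (4 * k)"
  assumes k: "k \<ge> 1" and x: "1 / p ^ (4 * k - 1) \<le> x" "x \<le> 1 / p ^ (4 * k + 1)"
    and small: "(1 / p ^ L - 1)\<^sup>2 - p * (1 - p\<^sup>2) + 1 / p ^ L * ((1 - p\<^sup>2) / (1 + p ^ 7)) < 0"
  shows "real_theta (- p) x < 0"
proof -
  define c where "c = (1 / p ^ L - 1)\<^sup>2 - p * (1 - p\<^sup>2)"
  define f where "f j = (- p) ^ tri j * x ^ j" for j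
  have p2: "p\<^sup>2 < 1" using p by (simp add: power_less_one_iff)
  have x1: "1 \<le> x" using x p by (intro order_trans[OF _ x(1)]) (simp add: power_le_one)
  have rest_nonneg: "0 \<le> 1 / p ^ L * ((1 - p\<^sup>2) / (1 + p ^ 7))"
    using p p2 by (intro mult_nonneg_nonneg divide_nonneg_nonneg) auto
  then have c0: "c < 0" using small by (simp add: c_def)
  have block: "f (4 * i) + f (4 * i + 1) + f (4 * i + 2) + f (4 * i + 3) \<le> p ^ tri (4 * i) * x ^ (4 * i) * c"
    if i: "i < k" for i
  proof -
    \<comment> \<open>The lower bound on x gives u \<ge> 1 / p in every block, hence u - 1 and p u^2
      - 1 are nonnegative; L is large enough to bound both by 1 / p^L - 1.\<close>
    define u where "u = p ^ (4 * i + 1) * x"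
    have "p ^ (4 * k - 2) * (1 / p ^ (4 * k - 1)) \<le> u"
      unfolding u_def using p i x by (intro mult_mono power_decreasing) auto
    moreover have "p ^ (4 * k - 1) = p ^ (4 * k - 2) * p"
    proof -
      have "4 * k - 1 = Suc (4 * k - 2)" using k by simp
      then show ?thesis by simp
    qed
    ultimately have u1: "1 / p \<le> u" using p by simp
    have "p ^ (4 * i + 1) * x \<le> 1 * x" using p x1 by (intro mult_right_mono power_le_one) auto
    then have ux: "u \<le> 1 / p ^ (4 * k + 1)" using x by (simp add: u_def)
    have pu: "1 \<le> p * u" using u1 p by (simp add: field_simps)
    have u1': "1 \<le> u" using pu p mult_right_mono[of p 1 u] u1 by (smt (verit) divide_pos_pos)
    have L1: "(4 * k + 1) * 2 \<le> L" unfolding L_def using k by (intro mult_le_mono) auto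
    have uL: "u \<le> 1 / p ^ L"
      using ux p L1 by (intro order_trans[OF ux] divide_left_mono power_decreasing) auto
    have "p * u\<^sup>2 \<le> 1 * u\<^sup>2" using p by (intro mult_right_mono) auto
    also have "1 * u\<^sup>2 \<le> (1 / p ^ (4 * k + 1))\<^sup>2" using ux u1' by (auto intro: power_mono)
    also have "\<dots> = 1 / p ^ ((4 * k + 1) * 2)" by (simp only: power_divide power_one power_mult)
    also have "\<dots> \<le> 1 / p ^ L" using p L1 by (intro divide_left_mono power_decreasing) auto
    finally have puL: "p * u\<^sup>2 \<le> 1 / p ^ L" .
    have pu2: "1 \<le> p * u\<^sup>2"
      using mult_mono[OF pu u1'] pu by (simp add: power2_eq_square mult.assoc)
    have "(u - 1) * (p * u\<^sup>2 - 1) \<le> (1 / p ^ L - 1) * (1 / p ^ L - 1)"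
      using uL puL u1' pu2 by (intro mult_mono) auto
    moreover have "p * 1 * (1 - p\<^sup>2) \<le> p * u ^ 3 * (1 - p\<^sup>2)"
      using p p2 u1' by (intro mult_right_mono mult_left_mono one_le_power) auto
    ultimately have "(u - 1) * (p * u\<^sup>2 - 1) - p * u ^ 3 * (1 - p\<^sup>2) \<le> c"
      by (simp add: c_def power2_eq_square)
    then have "p ^ tri (4 * i) * x ^ (4 * i) * ((u - 1) * (p * u\<^sup>2 - 1) - p * u ^ 3 * (1 - p\<^sup>2))
        \<le> p ^ tri (4 * i) * x ^ (4 * i) * c"
      using p x1 by (intro mult_left_mono) auto
    then show ?thesis unfolding f_def using theta_terms_block[OF u_def] by simp
  qed
  have group: "(\<Sum>j<4 * n. f j) = (\<Sum>i<n. f (4 * i) + f (4 * i + 1) + f (4 * i + 2) + f (4 * i + 3))" for n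
    by (induction n) (simp_all add: numeral_eq_Suc)
  \<comment> \<open>The first block alone outweighs the remainder, as c is about -2 (1 - p); the
    other blocks enter only through their sign.\<close>
  have "(\<Sum>j<4 * k. f j) \<le> (\<Sum>i<k. if i = 0 then c else 0)"
    unfolding group
  proof (rule sum_mono)
    fix i assume i: "i \<in> {..<k}"
    have "p ^ tri (4 * i) * x ^ (4 * i) * c \<le> 0" if "i \<noteq> 0"
      using c0 p x1 by (intro mult_nonneg_nonpos) auto
    then show "f (4 * i) + f (4 * i + 1) + f (4 * i + 2) + f (4 * i + 3) \<le> (if i = 0 then c else 0)"
      using block[of i] i by (cases "i = 0") auto
  qed
  also have "\<dots> = c" using k by simp
  finally have sum_le: "(\<Sum>j<4 * k. f j) \<le> c" .
  \<comment> \<open>The remainder is evaluated in [p, 1 / p], the range of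
    \<open>real_theta_neg_le\<close>.\<close>
  have xk: "p \<le> p ^ (4 * k) * x" "p ^ (4 * k) * x \<le> 1 / p"
  proof -
    have e: "p ^ (4 * k) = p * p ^ (4 * k - 1)" using k by (simp flip: power_Suc)
    have "p ^ (4 * k) * (1 / p ^ (4 * k - 1)) \<le> p ^ (4 * k) * x"
      using x p by (intro mult_left_mono) auto
    then show "p \<le> p ^ (4 * k) * x" using e p by simp
    have "p ^ (4 * k) * x \<le> p ^ (4 * k) * (1 / p ^ (4 * k + 1))"
      using x p by (intro mult_left_mono) auto
    then show "p ^ (4 * k) * x \<le> 1 / p" using p by simp
  qed
  have "real_theta (- p) x = (\<Sum>j<4 * k. f j) + x ^ (4 * k) * (- p) ^ tri (4 * k) * real_theta (- p) ((- p) ^ (4 * k) * x)"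
    unfolding f_def using p by (intro real_theta_split) auto
  also have "(- p) ^ tri (4 * k) = p ^ tri (4 * k)" using even_tri_4 by simp
  also have "(- p) ^ (4 * k) = p ^ (4 * k)" by simp
  also have "x ^ (4 * k) * p ^ tri (4 * k) * real_theta (- p) (p ^ (4 * k) * x) \<le>
      1 / p ^ L * ((1 - p\<^sup>2) / (1 + p ^ 7))"
  proof -
    have "x ^ (4 * k) * p ^ tri (4 * k) \<le> (1 / p ^ (4 * k + 1)) ^ (4 * k) * 1"
      using x x1 p by (intro mult_mono power_mono power_le_one) auto
    also have "\<dots> = 1 / p ^ L" by (simp only: power_divide power_one power_mult L_def mult_1_right)
    finally have a: "x ^ (4 * k) * p ^ tri (4 * k) \<le> 1 / p ^ L" .
    have "x ^ (4 * k) * p ^ tri (4 * k) * real_theta (- p) (p ^ (4 * k) * x) \<le>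
        x ^ (4 * k) * p ^ tri (4 * k) * ((1 - p\<^sup>2) / (1 + p ^ 7))"
      using x1 p xk by (intro mult_left_mono real_theta_neg_le) auto
    also have "\<dots> \<le> 1 / p ^ L * ((1 - p\<^sup>2) / (1 + p ^ 7))"
      using a p p2 by (intro mult_right_mono) auto
    finally show ?thesis .
  qed
  finally show ?thesis using sum_le small by (simp add: c_def)
qed

end

text \<open>The smallness condition of \<open>real_theta_neg_block_bound\<close> is divided by 1 -
  p^2. Bernoulli's inequality makes the square of second order in 1 - p, so the limit is 0 - 1 +
  1/2.\<close>

lemma real_theta_neg_near_1:
  assumes "k \<ge> 1"
  shows "\<forall>\<^sub>F p in at_left 1. \<forall>x. 1 / p ^ (4 * k - 1) \<le> x \<and> x \<le> 1 / p ^ (4 * k + 1) \<longrightarrow> real_theta (- p) x < 0"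
proof -
  define L where "L = (4 * k + 1) * (4 * k)"
  have "((\<lambda>p::real. (real L)\<^sup>2 * (1 - p) / (p ^ L)\<^sup>2 - p + 1 / p ^ L * (1 / (1 + p ^ 7))) \<longlongrightarrow>
      (real L)\<^sup>2 * (1 - 1) / (1 ^ L)\<^sup>2 - 1 + 1 / 1 ^ L * (1 / (1 + 1 ^ 7))) (at_left 1)"
    by (intro tendsto_intros) auto
  then have "\<forall>\<^sub>F p::real in at_left 1. (real L)\<^sup>2 * (1 - p) / (p ^ L)\<^sup>2 - p + 1 / p ^ L * (1 / (1 + p ^ 7)) < 0"
    by (rule order_tendstoD) simp
  moreover have "\<forall>\<^sub>F p in at_left (1::real). p \<in> {0<..<1}"
    by (rule eventually_at_leftI[of 0]) auto
  ultimately show ?thesis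
  proof eventually_elim
    case (elim p)
    then have p: "0 < p" "p < 1" by auto
    have p2: "p\<^sup>2 < 1" using p by (simp add: power_less_one_iff)
    have pp: "1 - p \<le> 1 - p\<^sup>2" using p mult_left_mono[of p 1 p] by (simp add: power2_eq_square)
    have "(1 / p ^ L - 1)\<^sup>2 = (1 - p ^ L)\<^sup>2 / (p ^ L)\<^sup>2"
      using p by (simp add: diff_divide_distrib flip: power_divide)
    also have "\<dots> \<le> (real L * (1 - p))\<^sup>2 / (p ^ L)\<^sup>2"
    proof (intro divide_right_mono power_mono)
      have "1 + real L * (p - 1) \<le> (1 + (p - 1)) ^ L"
        using p by (intro Bernoulli_inequality) auto
      then show "1 - p ^ L \<le> real L * (1 - p)" by (simp add: algebra_simps)
    qed (use p in \<open>auto simp: power_le_one\<close>)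
    also have "\<dots> \<le> (real L)\<^sup>2 * (1 - p) * (1 - p\<^sup>2) / (p ^ L)\<^sup>2"
      using p pp by (intro divide_right_mono) (auto simp: power2_eq_square mult.assoc intro!: mult_left_mono)
    finally have D: "(1 / p ^ L - 1)\<^sup>2 \<le> ((real L)\<^sup>2 * (1 - p) / (p ^ L)\<^sup>2) * (1 - p\<^sup>2)" by simp
    have "((real L)\<^sup>2 * (1 - p) / (p ^ L)\<^sup>2 - p + 1 / p ^ L * (1 / (1 + p ^ 7))) * (1 - p\<^sup>2) < 0"
      using elim p2 by (intro mult_neg_pos) auto
    then have "(1 / p ^ L - 1)\<^sup>2 - p * (1 - p\<^sup>2) + 1 / p ^ L * ((1 - p\<^sup>2) / (1 + p ^ 7)) < 0"
      using D by (simp only: distrib_right left_diff_distrib times_divide_eq_left times_divide_eq_right mult_1_left)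
    then show ?case
      using real_theta_neg_block_bound[OF p assms] unfolding L_def by blast
  qed
qed

text \<open>At negative arguments the halves of the bisection add, so positivity for the base P =
  p^4 suffices. Its range reaches 1 / P^(4 k) = 1 / p^(16 k), beyond the largest inner argument 1 /
  p^(8 k + 1).\<close>

lemma real_theta_neg_pos_near_1:
  assumes "k \<ge> 1"
  shows "\<exists>p. 1/2 < p \<and> p < 1 \<and> (\<forall>x. 0 \<le> x \<and> x \<le> 1 / p ^ (4 * k) \<longrightarrow> 0 < real_theta (- p) (- x))"
proof -
  have "\<exists>b<1. \<forall>P>b. P < 1 \<longrightarrow> (\<forall>y. 0 \<le> y \<and> y \<le> 1 / P ^ (2 * (2 * k)) \<longrightarrow> 0 < real_theta P (- y))"
    using phi_pos_near_1[of "2 * k"] assms by (simp only: eventually_at_left[OF zero_less_one])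
  then obtain b where b: "b < 1"
    "\<And>P y. b < P \<Longrightarrow> P < 1 \<Longrightarrow> 0 \<le> y \<Longrightarrow> y \<le> 1 / P ^ (2 * (2 * k)) \<Longrightarrow> 0 < real_theta P (- y)"
    by blast
  define P where "P = (max b (1/2) + 1) / 2"
  have P: "b < P" "1/2 < P" "P < 1" using b by (auto simp: P_def)
  define p where "p = sqrt (sqrt P)"
  have "p ^ 4 = (p\<^sup>2)\<^sup>2" by (simp flip: power_mult)
  then have p4: "p ^ 4 = P" using P by (simp add: p_def)
  have p: "0 < p" "p < 1" using P by (auto simp: p_def)
  have "p ^ 4 \<le> p ^ 1" using p by (intro power_decreasing) auto
  then have "1/2 < p" using P p4 by simp
  moreover have "0 < real_theta (- p) (- x)" if x: "0 \<le> x" "x \<le> 1 / p ^ (4 * k)" for x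
  proof -
    have "x\<^sup>2 \<le> (1 / p ^ (4 * k))\<^sup>2" using x by (intro power_mono) auto
    also have "\<dots> = 1 / p ^ (8 * k)" by (simp add: power_divide flip: power_mult)
    finally have x2: "x\<^sup>2 \<le> 1 / p ^ (8 * k)" .
    have e: "P ^ (2 * (2 * k)) = p ^ (16 * k)" by (simp add: p4[symmetric] flip: power_mult)
    have "x\<^sup>2 / p \<le> 1 / p ^ (8 * k) / p" using x2 p by (intro divide_right_mono) auto
    also have "\<dots> = 1 / p ^ (8 * k + 1)" by simp
    also have "\<dots> \<le> 1 / p ^ (16 * k)" using p assms by (intro divide_left_mono power_decreasing) auto
    finally have y1: "x\<^sup>2 / p \<le> 1 / P ^ (2 * (2 * k))" unfolding e .
    have "p * x\<^sup>2 \<le> x\<^sup>2 / p" using p mult_le_one[of p p] mult_right_mono[of "p * p" 1 "x\<^sup>2"] by (simp add: field_simps)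
    then have y2: "p * x\<^sup>2 \<le> 1 / P ^ (2 * (2 * k))" using y1 by linarith
    have "0 < real_theta P (- (x\<^sup>2 / p))" "0 < real_theta P (- (p * x\<^sup>2))"
      using y1 y2 P p by (auto intro!: b(2))
    then have "0 < real_theta P (- (x\<^sup>2 / p)) + p * x * real_theta P (- (p * x\<^sup>2))"
      using p x by (intro add_pos_nonneg) auto
    then show ?thesis using real_theta_neg_bisect[OF p, of "- x"] p4 by simp
  qed
  ultimately show ?thesis using p by blast
qed

section \<open>Joining the branches\<close>

lemma connected_component_Complex_line:
  assumes "s1 \<le> s2"
  shows "(\<And>s. s1 \<le> s \<Longrightarrow> s \<le> s2 \<Longrightarrow> Complex x s \<in> S) \<Longrightarrow> connected_component S (Complex x s1) (Complex x s2)"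
    and "(\<And>s. s1 \<le> s \<Longrightarrow> s \<le> s2 \<Longrightarrow> Complex s x \<in> S) \<Longrightarrow> connected_component S (Complex s1 x) (Complex s2 x)"
proof -
  have "connected ((\<lambda>s. Complex x s) ` {s1..s2})" "connected ((\<lambda>s. Complex s x) ` {s1..s2})"
    by (intro connected_continuous_image continuous_intros connected_Icc)+
  then show "(\<And>s. s1 \<le> s \<Longrightarrow> s \<le> s2 \<Longrightarrow> Complex x s \<in> S) \<Longrightarrow> connected_component S (Complex x s1) (Complex x s2)"
    "(\<And>s. s1 \<le> s \<Longrightarrow> s \<le> s2 \<Longrightarrow> Complex s x \<in> S) \<Longrightarrow> connected_component S (Complex s1 x) (Complex s2 x)"
    using assms unfolding connected_component_def by (metis (no_types, lifting) atLeastAtMost_iff image_eqI image_subsetI order_refl)+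
qed

text \<open>From (0, m), where h < 0, the corner (1, d), where h > 0, is reached off
  \<open>A\<close> along t = 0, s \<ge> m and then s = d, and off \<open>B\<close> along t = 0, s
  \<le> m, then s = c and t = 1. Janiszewski gives a connected set avoiding both, on which h must
  vanish. The reflection keeps this set from escaping through t = 0, where the sign of h is not
  controlled.\<close>

lemma rectangle_zero_set_not_separated:
  fixes h :: "real \<times> real \<Rightarrow> real"
  assumes cont: "continuous_on ({0..1} \<times> {c..d}) h" and m: "c < m" "m < d"
    and A: "compact A" and B: "compact B" and disj: "A \<inter> B = {}"
    and zeros: "A \<union> B = {x \<in> {0..1} \<times> {c..d}. h x = 0}"
    and side: "\<And>t. 0 \<le> t \<Longrightarrow> t \<le> 1 \<Longrightarrow> 0 < h (t, c)" "\<And>t. 0 \<le> t \<Longrightarrow> t \<le> 1 \<Longrightarrow> 0 < h (t, d)"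
    and top: "\<And>s. c \<le> s \<Longrightarrow> s \<le> d \<Longrightarrow> 0 < h (1, s)"
    and mid: "h (0, m) < 0"
    and left: "\<And>s. c \<le> s \<Longrightarrow> s \<le> m \<Longrightarrow> (0, s) \<notin> B"
    and right: "\<And>s. m \<le> s \<Longrightarrow> s \<le> d \<Longrightarrow> (0, s) \<notin> A"
  shows False
proof -
  \<comment> \<open>reflect the rectangle in its edge \<open>t = 0\<close>, so that \<open>h\<close> is positive on the whole new boundary\<close>
  define fold where "fold w = (\<bar>Re w\<bar>, Im w)" for w
  have cf: "continuous_on UNIV fold" unfolding fold_def by (intro continuous_intros)
  have AR: "A \<subseteq> {0..1} \<times> {c..d}" and BR: "B \<subseteq> {0..1} \<times> {c..d}"
    and A0: "\<And>x. x \<in> A \<Longrightarrow> h x = 0" and B0: "\<And>x. x \<in> B \<Longrightarrow> h x = 0"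
    using zeros by blast+
  have "fold -` A \<subseteq> cbox (Complex (- 1) c) (Complex 1 d)"
  proof
    fix w assume "w \<in> fold -` A"
    then have "(\<bar>Re w\<bar>, Im w) \<in> {0..1} \<times> {c..d}" using AR by (auto simp: fold_def)
    then show "w \<in> cbox (Complex (- 1) c) (Complex 1 d)" by (auto simp: in_cbox_complex_iff abs_le_iff)
  qed
  moreover have cA: "closed (fold -` A)" and cB: "closed (fold -` B)"
    by (rule closed_vimage[OF compact_imp_closed[OF A] cf], rule closed_vimage[OF compact_imp_closed[OF B] cf])
  ultimately have cpA: "compact (fold -` A)"
    by (meson bounded_cbox bounded_subset compact_eq_bounded_closed)
  have con1: "connected_component (- fold -` A) (Complex 0 m) (Complex 1 d)"
  proof (rule connected_component_trans)
    show "connected_component (- fold -` A) (Complex 0 m) (Complex 0 d)"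
      using m right by (intro connected_component_Complex_line(1)) (auto simp: fold_def)
    show "connected_component (- fold -` A) (Complex 0 d) (Complex 1 d)"
      using side(2) A0 by (intro connected_component_Complex_line(2)) (force simp: fold_def)+
  qed
  have con2: "connected_component (- fold -` B) (Complex 0 m) (Complex 1 d)"
  proof (rule connected_component_trans)
    have "connected_component (- fold -` B) (Complex 0 c) (Complex 0 m)"
      using m left by (intro connected_component_Complex_line(1)) (auto simp: fold_def)
    then show "connected_component (- fold -` B) (Complex 0 m) (Complex 0 c)"
      by (rule connected_component_sym)
    show "connected_component (- fold -` B) (Complex 0 c) (Complex 1 d)"
    proof (rule connected_component_trans)
      show "connected_component (- fold -` B) (Complex 0 c) (Complex 1 c)"
        using side(1) B0 by (intro connected_component_Complex_line(2)) (force simp: fold_def)+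
      show "connected_component (- fold -` B) (Complex 1 c) (Complex 1 d)"
        using m top B0 by (intro connected_component_Complex_line(1)) (force simp: fold_def)+
    qed
  qed
  have "connected (fold -` A \<inter> fold -` B)"
    using disj by (simp flip: vimage_Int)
  then have "connected_component (- (fold -` A \<union> fold -` B)) (Complex 0 m) (Complex 1 d)"
    by (rule Janiszewski[OF cpA cB _ con1 con2])
  then obtain T where T: "connected T" "T \<subseteq> - (fold -` A \<union> fold -` B)" "Complex 0 m \<in> T" "Complex 1 d \<in> T"
    unfolding connected_component_def by blast
  \<comment> \<open>\<open>g\<close> extends h by folding and clamping to the rectangle. Since h is
    positive on the edges s = c, s = d and t = 1, no zero of \<open>g\<close> comes from a clamped
    coordinate.\<close>
  define g where "g w = h (min 1 \<bar>Re w\<bar>, max c (min d (Im w)))" for w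
  have "continuous_on T g"
    unfolding g_def using m
    by (intro continuous_on_compose2[OF cont] continuous_intros) auto
  then have "connected (g ` T)" using T by (intro connected_continuous_image)
  moreover have "g (Complex 0 m) < 0" "0 < g (Complex 1 d)"
    using m mid side(2) by (auto simp: g_def)
  ultimately have "0 \<in> g ` T"
    using T by (intro connectedD_interval[of "g ` T" "g (Complex 0 m)" "g (Complex 1 d)" 0]) auto
  then obtain w where w: "w \<in> T" "g w = 0" by force
  define t s where "t = min 1 \<bar>Re w\<bar>" and "s = max c (min d (Im w))"
  have ts: "0 \<le> t" "t \<le> 1" "c \<le> s" "s \<le> d" using m by (auto simp: t_def s_def)
  have h0: "h (t, s) = 0" using w by (simp add: g_def t_def s_def)
  have "t \<noteq> 1" "s \<noteq> c" "s \<noteq> d" using h0 ts side[of t] top[of s] by auto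
  then have "fold w = (t, s)" by (auto simp: fold_def t_def s_def)
  moreover have "(t, s) \<in> A \<union> B" using h0 ts by (auto simp: zeros)
  ultimately show False using w T by auto
qed

abbreviation base_point :: real where "base_point \<equiv> 1/256"

lemma base_point_powr: "base_point powr (1/4) = 1/4"
proof -
  have "base_point = (1/4) powr 4" by (simp add: powr_numeral power_divide)
  then show ?thesis by (simp only: powr_powr) simp
qed

text \<open>With e = j + 1 - s, the number z q^(j+1) is a sign times (1/256)^e and lies within 1/2
  of -1. So the sign is -1 and the power lies in [1/2, 3/2], strictly between its values 1/4 at e =
  1/4 and 4 at e = -1/4.\<close>

lemma branch_of_real_zero:
  assumes "(of_real (\<sigma> * base_point), of_real (\<tau> * base_point powr (- s))) \<in> branch j"
    and "\<bar>\<tau>\<bar> = 1" "\<bar>\<sigma>\<bar> = 1"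
  shows "\<tau> * \<sigma> ^ Suc j = - 1 \<and> \<bar>real (Suc j) - s\<bar> < 1/4"
proof -
  define v where "v = \<tau> * \<sigma> ^ Suc j"
  define e where "e = real (Suc j) - s"
  have "base_point powr (- s) * base_point ^ Suc j = base_point powr e"
    unfolding e_def by (subst powr_realpow[symmetric]) (simp_all add: powr_add[symmetric] algebra_simps)
  then have eq: "(\<tau> * base_point powr (- s)) * (\<sigma> * base_point) ^ Suc j = v * base_point powr e"
    unfolding v_def power_mult_distrib by (metis (no_types, lifting) mult.assoc mult.left_commute)
  have "norm (of_real (\<tau> * base_point powr (- s)) * of_real (\<sigma> * base_point) ^ Suc j + 1 :: complex) \<le> 1/2"
    using assms(1) unfolding branch_def by blast
  also have "of_real (\<tau> * base_point powr (- s)) * of_real (\<sigma> * base_point) ^ Suc j + 1 =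
      complex_of_real ((\<tau> * base_point powr (- s)) * (\<sigma> * base_point) ^ Suc j + 1)"
    by (simp only: of_real_add of_real_mult of_real_power of_real_1)
  finally have r: "\<bar>v * base_point powr e + 1\<bar> \<le> 1/2"
    unfolding eq norm_of_real .
  have "\<bar>v\<bar> = 1" using assms by (simp add: v_def abs_mult power_abs)
  then have v: "v = 1 \<or> v = - 1" by linarith
  have pos: "0 < base_point powr e" by simp
  have v1: "v = - 1"
  proof (rule ccontr)
    assume "v \<noteq> - 1"
    then have "\<bar>base_point powr e + 1\<bar> \<le> 1/2" using v r by (metis mult_1_left)
    then show False using pos by linarith
  qed
  then have "\<bar>- (base_point powr e) + 1\<bar> \<le> 1/2" using r by (metis mult_minus1)
  then have b: "1/2 \<le> base_point powr e" "base_point powr e \<le> 3/2" by linarith+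
  have "e < 1/4"
  proof (rule ccontr)
    assume "\<not> e < 1/4"
    then have "base_point powr e \<le> base_point powr (1/4)" by (intro powr_mono') auto
    then show False using b unfolding base_point_powr by simp
  qed
  moreover have "- 1/4 < e"
  proof (rule ccontr)
    assume "\<not> - 1/4 < e"
    then have "base_point powr (- (1/4)) \<le> base_point powr e" by (intro powr_mono') auto
    then show False using b unfolding powr_minus base_point_powr by simp
  qed
  ultimately have "\<bar>e\<bar> < 1/4" by linarith
  then show ?thesis using v1 unfolding v_def e_def by blast
qed

lemma powr_minus_nat:
  fixes p :: real
  assumes "0 < p"
  shows "p powr (- real n) = 1 / p ^ n"
  using assms by (simp add: powr_minus powr_realpow divide_inverse)

text \<open>Common frame of the three families: \<open>\<sigma>\<close> and \<open>\<tau>\<close>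
  are the signs of q and z, \<open>\<epsilon>\<close> is the sign of theta on the three confining
  edges. The parameter t moves |q| from 1/256 to \<open>p1\<close>, and |z| = |q|^(-s). At s = m on
  the initial edge theta has the opposite sign, and m separates the branches a and b there.\<close>

lemma branches_not_separated:
  fixes a b :: nat and \<sigma> \<tau> \<epsilon> m p1 :: real
  assumes sep: "theta_separation A B" and brA: "branch a \<subseteq> A" and brB: "branch b \<subseteq> B"
    and signs: "\<bar>\<sigma>\<bar> = 1" "\<bar>\<tau>\<bar> = 1" "\<bar>\<epsilon>\<bar> = 1"
    and p1: "1/2 < p1" "p1 < 1" and m: "real (Suc a) < m" "m < real (Suc b)"
    and ends: "\<And>p. 0 < p \<Longrightarrow> p < 1 \<Longrightarrow> 0 < \<epsilon> * real_theta (\<sigma> * p) (\<tau> / p ^ Suc a)"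
      "\<And>p. 0 < p \<Longrightarrow> p < 1 \<Longrightarrow> 0 < \<epsilon> * real_theta (\<sigma> * p) (\<tau> / p ^ Suc b)"
    and top: "\<And>x. 1 / p1 ^ Suc a \<le> x \<Longrightarrow> x \<le> 1 / p1 ^ Suc b \<Longrightarrow> 0 < \<epsilon> * real_theta (\<sigma> * p1) (\<tau> * x)"
    and mid: "\<epsilon> * real_theta (\<sigma> * base_point) (\<tau> * base_point powr (- m)) < 0"
    and left: "\<And>s j. real (Suc a) \<le> s \<Longrightarrow> s \<le> m \<Longrightarrow> \<tau> * \<sigma> ^ Suc j = - 1 \<Longrightarrow> \<bar>real (Suc j) - s\<bar> < 1/4 \<Longrightarrow> j = a"
    and right: "\<And>s j. m \<le> s \<Longrightarrow> s \<le> real (Suc b) \<Longrightarrow> \<tau> * \<sigma> ^ Suc j = - 1 \<Longrightarrow> \<bar>real (Suc j) - s\<bar> < 1/4 \<Longrightarrow> j = b"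
  shows False
proof -
  define c d where "c = real (Suc a)" and "d = real (Suc b)"
  let ?R = "{0..1::real} \<times> {c..d}"
  define P where "P t = base_point + t * (p1 - base_point)" for t
  have P: "0 < P t" "P t < 1" if "0 \<le> t" "t \<le> 1" for t
  proof -
    have "0 \<le> t * (p1 - base_point)" using that p1 by (intro mult_nonneg_nonneg) auto
    then show "0 < P t" by (simp add: P_def)
    have "t * (p1 - base_point) \<le> 1 * (p1 - base_point)" using that p1 by (intro mult_right_mono) auto
    then have "P t \<le> base_point + 1 * (p1 - base_point)"
      unfolding P_def by (rule add_left_mono)
    then show "P t < 1" using p1 by simp
  qed
  define Q :: "real \<times> real \<Rightarrow> complex \<times> complex"
    where "Q x = (of_real (\<sigma> * P (fst x)), of_real (\<tau> * P (fst x) powr (- snd x)))" for x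
  define h where "h x = \<epsilon> * Re (partial_theta (fst (Q x)) (snd (Q x)))" for x
  have sP: "\<bar>\<sigma> * P t\<bar> < 1" if "0 \<le> t" "t \<le> 1" for t
    using P[OF that] signs by (simp add: abs_mult)
  have theta_eq: "partial_theta (fst (Q x)) (snd (Q x)) =
      of_real (real_theta (\<sigma> * P (fst x)) (\<tau> * P (fst x) powr (- snd x)))" if "x \<in> ?R" for x
    unfolding Q_def fst_conv snd_conv using that by (intro partial_theta_of_real sP) auto
  have h_eq: "h x = \<epsilon> * real_theta (\<sigma> * P (fst x)) (\<tau> * P (fst x) powr (- snd x))" if "x \<in> ?R" for x
    using theta_eq[OF that] by (simp add: h_def)
  have Qcont: "continuous_on ?R Q"
    unfolding Q_def P_def using P by (intro continuous_intros) (force simp: P_def)+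
  have normQ: "norm (fst (Q x)) < 1" if "x \<in> ?R" for x
    using that sP[of "fst x"] unfolding Q_def fst_conv norm_of_real by auto
  have hcont: "continuous_on ?R h"
    unfolding h_def
    by (intro continuous_intros continuous_on_theta_comp continuous_on_fst continuous_on_snd Qcont normQ)
  have zero_iff: "h x = 0 \<longleftrightarrow> Q x \<in> theta_zeros" if "x \<in> ?R" for x
  proof -
    have "Q x \<in> theta_zeros \<longleftrightarrow> partial_theta (fst (Q x)) (snd (Q x)) = 0"
      using normQ[OF that] theta_zeros_iff[of "fst (Q x)" "snd (Q x)"] by simp
    then show ?thesis using theta_eq[OF that] h_eq[OF that] signs by auto
  qed
  have closed0: "closed {x \<in> ?R. h x = 0}"
    using hcont by (intro continuous_closed_preimage_constant closed_Times) auto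
  have cpt: "compact ({x \<in> ?R. h x = 0} \<inter> (?R \<inter> Q -` C))" if "closed C" for C
  proof -
    have cR: "compact ?R" by (intro compact_Times) auto
    have "closed (?R \<inter> Q -` C)"
      by (rule continuous_closed_preimage[OF Qcont compact_imp_closed[OF cR] that])
    then have "compact (?R \<inter> ({x \<in> ?R. h x = 0} \<inter> (?R \<inter> Q -` C)))"
      by (rule compact_Int_closed[OF cR closed_Int[OF closed0]])
    also have "?R \<inter> ({x \<in> ?R. h x = 0} \<inter> (?R \<inter> Q -` C)) = {x \<in> ?R. h x = 0} \<inter> (?R \<inter> Q -` C)" by auto
    finally show ?thesis .
  qed
  have AB: "closed A" "closed B" "theta_zeros \<subseteq> A \<union> B" "A \<inter> B \<inter> theta_zeros = {}"
    using sep by (auto simp: theta_separation_def)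
  have Q0: "Q (0, s) = (of_real (\<sigma> * base_point), of_real (\<tau> * base_point powr (- s)))" for s
    by (simp add: Q_def P_def)
  have small: "\<exists>j. Q (0, s) \<in> branch j \<and> \<tau> * \<sigma> ^ Suc j = - 1 \<and> \<bar>real (Suc j) - s\<bar> < 1/4"
    if Qs: "Q (0, s) \<in> theta_zeros" for s
  proof -
    have "norm (complex_of_real (\<sigma> * base_point)) < 1/100"
      unfolding norm_of_real abs_mult signs by simp
    then obtain j where "Q (0, s) \<in> branch j"
      using small_zero_in_branch Qs unfolding Q0 by blast
    then show ?thesis using branch_of_real_zero signs unfolding Q0 by blast
  qed
  have powr_end: "P t powr (- c) = 1 / P t ^ Suc a" "P t powr (- d) = 1 / P t ^ Suc b"
    if "0 \<le> t" "t \<le> 1" for t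
    unfolding c_def d_def using P(1)[OF that] by (intro powr_minus_nat; simp)+
  have cmd: "c < m" "m < d" using m by (auto simp: c_def d_def)
  show False
  proof (rule rectangle_zero_set_not_separated[OF hcont cmd cpt[OF AB(1)] cpt[OF AB(2)]])
    show "{x \<in> ?R. h x = 0} \<inter> (?R \<inter> Q -` A) \<inter> ({x \<in> ?R. h x = 0} \<inter> (?R \<inter> Q -` B)) = {}"
      using zero_iff AB(4) by blast
    show "{x \<in> ?R. h x = 0} \<inter> (?R \<inter> Q -` A) \<union> ({x \<in> ?R. h x = 0} \<inter> (?R \<inter> Q -` B)) = {x \<in> ?R. h x = 0}"
      using zero_iff AB(3) by blast
    show "0 < h (t, c)" if "0 \<le> t" "t \<le> 1" for t
      using ends(1)[OF P[OF that]] powr_end[OF that] cmd that by (subst h_eq) auto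
    show "0 < h (t, d)" if "0 \<le> t" "t \<le> 1" for t
      using ends(2)[OF P[OF that]] powr_end[OF that] cmd that by (subst h_eq) auto
    show "0 < h (1, s)" if s: "c \<le> s" "s \<le> d" for s
    proof -
      have "p1 powr (- c) \<le> p1 powr (- s)" "p1 powr (- s) \<le> p1 powr (- d)"
        using p1 s by (intro powr_mono'; simp)+
      moreover have "P 1 = p1" by (simp add: P_def)
      ultimately show ?thesis
        using top[of "p1 powr (- s)"] powr_end[of 1] s by (subst h_eq) auto
    qed
    show "h (0, m) < 0" using mid cmd by (subst h_eq) (auto simp: P_def)
    show "(0, s) \<notin> {x \<in> ?R. h x = 0} \<inter> (?R \<inter> Q -` B)" if s: "c \<le> s" "s \<le> m" for s
    proof
      assume *: "(0, s) \<in> {x \<in> ?R. h x = 0} \<inter> (?R \<inter> Q -` B)"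
      then have Q: "Q (0, s) \<in> theta_zeros" "Q (0, s) \<in> B" using zero_iff by blast+
      from small[OF Q(1)] left s have "Q (0, s) \<in> branch a" unfolding c_def by blast
      then show False using Q brA AB(4) by blast
    qed
    show "(0, s) \<notin> {x \<in> ?R. h x = 0} \<inter> (?R \<inter> Q -` A)" if s: "m \<le> s" "s \<le> d" for s
    proof
      assume *: "(0, s) \<in> {x \<in> ?R. h x = 0} \<inter> (?R \<inter> Q -` A)"
      then have Q: "Q (0, s) \<in> theta_zeros" "Q (0, s) \<in> A" using zero_iff by blast+
      from small[OF Q(1)] right s have "Q (0, s) \<in> branch b" unfolding d_def by blast
      then show False using Q brB AB(4) by blast
    qed
  qed
qed

section \<open>The three families of neighbouring real zeros\<close>

lemma neg_one_power_eq: "(- 1 :: real) ^ n = - 1 \<longleftrightarrow> odd n" "(- 1 :: real) ^ n = 1 \<longleftrightarrow> even n"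
  by (cases "even n"; simp)+

lemma factor_sign:
  fixes x y :: real
  shows "0 < x * y \<Longrightarrow> x < 0 \<Longrightarrow> y < 0" and "0 < x * y \<Longrightarrow> 0 < x \<Longrightarrow> - y < 0"
  by (simp_all add: zero_less_mult_iff)

lemma index_bounds:
  fixes s x y :: real
  assumes "x \<le> s" "s \<le> y" "\<bar>real J - s\<bar> < 1/4"
  shows "x - 1/4 < real J" "real J < y + 1/4"
  using assms by linarith+

text \<open>For q > 0 and z < 0 theta is positive at every positive integer s
  (\<open>real_theta_end_pos\<close>), so a negative value must be sought elsewhere: s = 2 n + 2 -
  1/4 means t = -1/4 in the window of index 2 n + 1, and the odd power of t gives the sign.\<close>

lemma not_separated_positive_q:
  assumes sep: "theta_separation A B" and "branch (2 * n) \<subseteq> A" "branch (2 * n + 1) \<subseteq> B"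
  shows False
proof -
  have "\<forall>\<^sub>F p in at_left (1::real). p \<in> {1/2<..<1}"
    by (rule eventually_at_leftI[of "1/2"]) auto
  with phi_pos_near_1[of "n + 1"]
  have "\<forall>\<^sub>F p in at_left (1::real). p \<in> {1/2<..<1} \<and>
      (\<forall>y. 0 \<le> y \<and> y \<le> 1 / p ^ (2 * (n + 1)) \<longrightarrow> 0 < real_theta p (- y))"
    by (intro eventually_conj) auto
  from eventually_happens'[OF trivial_limit_at_left_real this] obtain p1
    where p1: "1/2 < p1" "p1 < 1" "\<And>y. 0 \<le> y \<Longrightarrow> y \<le> 1 / p1 ^ (2 * (n + 1)) \<Longrightarrow> 0 < real_theta p1 (- y)"
    by auto
  show False
  proof (rule branches_not_separated[OF assms, of 1 "- 1" 1 p1 "real (2 * n + 2) - 1/4"])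
    show "0 < 1 * real_theta (1 * p) (- 1 / p ^ Suc (2 * n))" "0 < 1 * real_theta (1 * p) (- 1 / p ^ Suc (2 * n + 1))"
      if "0 < p" "p < 1" for p
      using real_theta_end_pos[OF that, of "Suc (2 * n)"] real_theta_end_pos[OF that, of "Suc (2 * n + 1)"] by simp_all
    show "0 < 1 * real_theta (1 * p1) (- 1 * x)" if "1 / p1 ^ Suc (2 * n) \<le> x" "x \<le> 1 / p1 ^ Suc (2 * n + 1)" for x
    proof -
      have "0 \<le> 1 / p1 ^ Suc (2 * n)" using p1 by simp
      then have "0 \<le> x" using that(1) by (rule order_trans)
      then show ?thesis using that p1(3)[of x] by simp
    qed
    show "1 * real_theta (1 * base_point) (- 1 * base_point powr - (real (2 * n + 2) - 1/4)) < 0"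
    proof -
      have "base_point powr - (real (2 * n + 2) - 1/4) = base_point powr (1/4) * base_point powr (- real (2 * n + 2))"
        by (simp flip: powr_add)
      also have "\<dots> = 1/4 / base_point ^ Suc (2 * n + 1)"
        unfolding base_point_powr by (subst powr_minus_nat) auto
      finally have eq: "- 1 * base_point powr - (real (2 * n + 2) - 1/4) = (- 1/4) / base_point ^ Suc (2 * n + 1)"
        by simp
      have "0 < base_point ^ tri (2 * n + 1) * (- 1/4) ^ (2 * n + 1) * real_theta base_point ((- 1/4) / base_point ^ Suc (2 * n + 1))"
        by (rule real_theta_shift_pos) auto
      moreover have "base_point ^ tri (2 * n + 1) * (- 1/4) ^ (2 * n + 1) < 0"
        by (intro mult_pos_neg) (auto simp: power_less_zero_eq)
      ultimately show ?thesis unfolding eq mult_1_left by (rule factor_sign(1))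
    qed
    show "j = 2 * n" if "real (Suc (2 * n)) \<le> s" "s \<le> real (2 * n + 2) - 1/4"
      "\<bar>real (Suc j) - s\<bar> < 1/4" for s j
    proof -
      have "real (2 * n) < real (Suc j)" "real (Suc j) < real (2 * n + 2)"
        using index_bounds[OF that] by auto
      then have "2 * n < Suc j" "Suc j < 2 * n + 2" by (simp_all only: of_nat_less_iff)
      then show ?thesis by simp
    qed
    show "j = 2 * n + 1" if "real (2 * n + 2) - 1/4 \<le> s" "s \<le> real (Suc (2 * n + 1))"
      "\<bar>real (Suc j) - s\<bar> < 1/4" for s j
    proof -
      have "real (2 * n + 1) < real (Suc j)" "real (Suc j) < real (2 * n + 3)"
        using index_bounds[OF that] by auto
      then have "2 * n + 1 < Suc j" "Suc j < 2 * n + 3" by (simp_all only: of_nat_less_iff)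
      then show ?thesis by simp
    qed
  qed (use p1 in auto)
qed

lemma real_theta_neg_at_base:
  "0 < (- base_point) ^ tri m * real_theta (- base_point) (1 / (- base_point) ^ Suc m)"
  using real_theta_shift_pos[of "- base_point" 1 m] by simp

lemma odd_tri: "odd (tri (4 * n + 2))" and even_tri: "even (tri (4 * n + 3))"
proof -
  have "tri (4 * n + 2) = (2 * n + 1) * (4 * n + 3)" "tri (4 * n + 3) = 2 * ((4 * n + 3) * (n + 1))"
    using two_tri[of "4 * n + 2"] two_tri[of "4 * n + 3"] by (auto simp: algebra_simps)
  then show "odd (tri (4 * n + 2))" "even (tri (4 * n + 3))" by simp_all
qed

text \<open>For q < 0 and z < 0 only branches with even j + 1 occur, so the odd integer 4 n + 3 can
  be the middle point. There t = 1, and theta has the sign of (-1)^(tri (4 n + 2)), which is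
  -1.\<close>

lemma not_separated_negative_q:
  assumes sep: "theta_separation A B" and "branch (4 * n + 1) \<subseteq> A" "branch (4 * n + 3) \<subseteq> B"
  shows False
proof -
  obtain p1 where p1: "1/2 < p1" "p1 < 1"
    "\<And>x. 0 \<le> x \<Longrightarrow> x \<le> 1 / p1 ^ (4 * (n + 1)) \<Longrightarrow> 0 < real_theta (- p1) (- x)"
    using real_theta_neg_pos_near_1[of "n + 1"] by auto
  show False
  proof (rule branches_not_separated[OF assms, of "- 1" "- 1" 1 p1 "real (4 * n + 3)"])
    show "0 < 1 * real_theta (- 1 * p) (- 1 / p ^ Suc (4 * n + 1))" "0 < 1 * real_theta (- 1 * p) (- 1 / p ^ Suc (4 * n + 3))"
      if "0 < p" "p < 1" for p
      using real_theta_neg_end_even[OF that, of "Suc (4 * n + 1)"] real_theta_neg_end_even[OF that, of "Suc (4 * n + 3)"] by simp_all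
    show "0 < 1 * real_theta (- 1 * p1) (- 1 * x)" if "1 / p1 ^ Suc (4 * n + 1) \<le> x" "x \<le> 1 / p1 ^ Suc (4 * n + 3)" for x
    proof -
      have "0 \<le> 1 / p1 ^ Suc (4 * n + 1)" using p1 by simp
      then have "0 \<le> x" using that(1) by (rule order_trans)
      moreover have "Suc (4 * n + 3) = 4 * (n + 1)" by simp
      ultimately show ?thesis using that p1(3)[of x] by simp
    qed
    show "1 * real_theta (- 1 * base_point) (- 1 * base_point powr - real (4 * n + 3)) < 0"
    proof -
      have e: "4 * n + 3 = Suc (4 * n + 2)" by simp
      have pow: "(- base_point) ^ Suc (4 * n + 2) = - (base_point ^ Suc (4 * n + 2))"
        by (rule power_minus_odd) simp
      have "base_point powr - real (4 * n + 3) = 1 / base_point ^ Suc (4 * n + 2)"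
        unfolding e by (rule powr_minus_nat) simp
      then have eq: "- 1 * base_point powr - real (4 * n + 3) = 1 / (- base_point) ^ Suc (4 * n + 2)"
        by (simp only: pow mult_minus1 divide_minus_right)
      have "(- base_point) ^ tri (4 * n + 2) < 0"
        using odd_tri by (simp add: power_less_zero_eq)
      then have "real_theta (- base_point) (1 / (- base_point) ^ Suc (4 * n + 2)) < 0"
        by (rule factor_sign(1)[OF real_theta_neg_at_base])
      then show ?thesis unfolding eq by simp
    qed
    show "j = 4 * n + 1" if "real (Suc (4 * n + 1)) \<le> s" "s \<le> real (4 * n + 3)"
      "- 1 * (- 1) ^ Suc j = (- 1 :: real)" "\<bar>real (Suc j) - s\<bar> < 1/4" for s j
    proof -
      have "even (Suc j)" using that(3) by (simp add: neg_one_power_eq)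
      moreover have "real (4 * n + 1) < real (Suc j)" "real (Suc j) < real (4 * n + 4)"
        using index_bounds[OF that(1,2,4)] by auto
      then have "4 * n + 1 < Suc j" "Suc j < 4 * n + 4" by (simp_all only: of_nat_less_iff)
      ultimately show ?thesis by presburger
    qed
    show "j = 4 * n + 3" if "real (4 * n + 3) \<le> s" "s \<le> real (Suc (4 * n + 3))"
      "- 1 * (- 1) ^ Suc j = (- 1 :: real)" "\<bar>real (Suc j) - s\<bar> < 1/4" for s j
    proof -
      have "even (Suc j)" using that(3) by (simp add: neg_one_power_eq)
      moreover have "real (4 * n + 2) < real (Suc j)" "real (Suc j) < real (4 * n + 5)"
        using index_bounds[OF that(1,2,4)] by auto
      then have "4 * n + 2 < Suc j" "Suc j < 4 * n + 5" by (simp_all only: of_nat_less_iff)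
      ultimately show ?thesis by presburger
    qed
  qed (use p1 in auto)
qed

text \<open>For z > 0 only branches with odd j + 1 occur. At the middle point 4 n + 4 again t = 1,
  and theta has the sign of (-1)^(tri (4 n + 3)), which is 1, against the negative ends.\<close>

lemma not_separated_negative_q_positive_z:
  assumes sep: "theta_separation A B" and "branch (4 * n + 2) \<subseteq> A" "branch (4 * n + 4) \<subseteq> B"
  shows False
proof -
  have "\<forall>\<^sub>F p in at_left (1::real). p \<in> {1/2<..<1}"
    by (rule eventually_at_leftI[of "1/2"]) auto
  with real_theta_neg_near_1[of "n + 1"]
  have "\<forall>\<^sub>F p in at_left (1::real). p \<in> {1/2<..<1} \<and>
      (\<forall>x. 1 / p ^ (4 * (n + 1) - 1) \<le> x \<and> x \<le> 1 / p ^ (4 * (n + 1) + 1) \<longrightarrow> real_theta (- p) x < 0)"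
    by (intro eventually_conj) auto
  from eventually_happens'[OF trivial_limit_at_left_real this] obtain p1
    where p1: "1/2 < p1" "p1 < 1"
      "\<And>x. 1 / p1 ^ (4 * (n + 1) - 1) \<le> x \<Longrightarrow> x \<le> 1 / p1 ^ (4 * (n + 1) + 1) \<Longrightarrow> real_theta (- p1) x < 0"
    by auto
  have e: "4 * (n + 1) - 1 = Suc (4 * n + 2)" "4 * (n + 1) + 1 = Suc (4 * n + 4)" by simp_all
  show False
  proof (rule branches_not_separated[OF assms, of "- 1" 1 "- 1" p1 "real (4 * n + 4)"])
    show "0 < - 1 * real_theta (- 1 * p) (1 / p ^ Suc (4 * n + 2))" "0 < - 1 * real_theta (- 1 * p) (1 / p ^ Suc (4 * n + 4))"
      if "0 < p" "p < 1" for p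
      using real_theta_neg_end_odd[OF that, of "Suc (4 * n + 2)"] real_theta_neg_end_odd[OF that, of "Suc (4 * n + 4)"] by simp_all
    show "0 < - 1 * real_theta (- 1 * p1) (1 * x)" if "1 / p1 ^ Suc (4 * n + 2) \<le> x" "x \<le> 1 / p1 ^ Suc (4 * n + 4)" for x
      using that p1(3)[of x] unfolding e by simp
    show "- 1 * real_theta (- 1 * base_point) (1 * base_point powr - real (4 * n + 4)) < 0"
    proof -
      have e: "4 * n + 4 = Suc (4 * n + 3)" by simp
      have pow: "(- base_point) ^ Suc (4 * n + 3) = base_point ^ Suc (4 * n + 3)"
        by (rule power_minus_even) simp
      have "base_point powr - real (4 * n + 4) = 1 / base_point ^ Suc (4 * n + 3)"
        unfolding e by (rule powr_minus_nat) simp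
      then have eq: "1 * base_point powr - real (4 * n + 4) = 1 / (- base_point) ^ Suc (4 * n + 3)"
        by (simp only: pow mult_1_left)
      have "0 < (- base_point) ^ tri (4 * n + 3)"
        using even_tri by (simp add: zero_less_power_eq)
      then have "- real_theta (- base_point) (1 / (- base_point) ^ Suc (4 * n + 3)) < 0"
        by (rule factor_sign(2)[OF real_theta_neg_at_base])
      then show ?thesis unfolding eq by simp
    qed
    show "j = 4 * n + 2" if "real (Suc (4 * n + 2)) \<le> s" "s \<le> real (4 * n + 4)"
      "1 * (- 1) ^ Suc j = (- 1 :: real)" "\<bar>real (Suc j) - s\<bar> < 1/4" for s j
    proof -
      have "odd (Suc j)" using that(3) by (simp add: neg_one_power_eq)
      moreover have "real (4 * n + 2) < real (Suc j)" "real (Suc j) < real (4 * n + 5)"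
        using index_bounds[OF that(1,2,4)] by auto
      then have "4 * n + 2 < Suc j" "Suc j < 4 * n + 5" by (simp_all only: of_nat_less_iff)
      ultimately show ?thesis by presburger
    qed
    show "j = 4 * n + 4" if "real (4 * n + 4) \<le> s" "s \<le> real (Suc (4 * n + 4))"
      "1 * (- 1) ^ Suc j = (- 1 :: real)" "\<bar>real (Suc j) - s\<bar> < 1/4" for s j
    proof -
      have "odd (Suc j)" using that(3) by (simp add: neg_one_power_eq)
      moreover have "real (4 * n + 3) < real (Suc j)" "real (Suc j) < real (4 * n + 6)"
        using index_bounds[OF that(1,2,4)] by auto
      then have "4 * n + 3 < Suc j" "Suc j < 4 * n + 6" by (simp_all only: of_nat_less_iff)
      ultimately show ?thesis by presburger
    qed
  qed (use p1 in auto)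
qed

text \<open>\<open>branch\<close> counts from 0, so the chain reads 0-1-3-2-4-...: each block of
  four is entered at 4 n and left through 4 n + 2.\<close>

lemma all_branches_same_side:
  assumes sep: "theta_separation A B" and b0: "branch 0 \<subseteq> A"
  shows "branch j \<subseteq> A"
proof -
  have or: "branch i \<subseteq> A \<or> branch i \<subseteq> B" for i
    using theta_separation_connected[OF sep connected_branch, of i] by (auto simp: branch_def)
  have p1: "branch (2 * n) \<subseteq> A \<longleftrightarrow> branch (2 * n + 1) \<subseteq> A" for n
    using or not_separated_positive_q[OF sep] not_separated_positive_q[OF theta_separation_sym[OF sep]] by meson
  have p2: "branch (4 * n + 1) \<subseteq> A \<longleftrightarrow> branch (4 * n + 3) \<subseteq> A" for n
    using or not_separated_negative_q[OF sep] not_separated_negative_q[OF theta_separation_sym[OF sep]] by meson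
  have p3: "branch (4 * n + 2) \<subseteq> A \<longleftrightarrow> branch (4 * n + 4) \<subseteq> A" for n
    using or not_separated_negative_q_positive_z[OF sep] not_separated_negative_q_positive_z[OF theta_separation_sym[OF sep]] by meson
  have block: "branch (4 * n + 1) \<subseteq> A \<and> branch (4 * n + 3) \<subseteq> A \<and> branch (4 * n + 2) \<subseteq> A"
    if "branch (4 * n) \<subseteq> A" for n
  proof -
    have "branch (4 * n + 1) \<subseteq> A" using p1[of "2 * n"] that by simp
    moreover have "branch (4 * n + 3) \<subseteq> A" using calculation p2 by simp
    moreover have "2 * (2 * n + 1) = 4 * n + 2" "2 * (2 * n + 1) + 1 = 4 * n + 3" by simp_all
    then have "branch (4 * n + 2) \<subseteq> A" using calculation p1[of "2 * n + 1"] by metis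
    ultimately show ?thesis by blast
  qed
  have b4: "branch (4 * n) \<subseteq> A" for n
  proof (induction n)
    case (Suc n)
    then show ?case using block[of n] p3[of n] by (simp add: add.commute)
  qed (use b0 in simp)
  have "j = 4 * (j div 4) + 0 \<or> j = 4 * (j div 4) + 1 \<or> j = 4 * (j div 4) + 2 \<or> j = 4 * (j div 4) + 3"
    by presburger
  then show ?thesis using b4[of "j div 4"] block[of "j div 4"] by (metis add_0_right)
qed

lemma connected_theta_zeros: "connected theta_zeros"
proof (rule ccontr)
  assume "\<not> connected theta_zeros"
  then obtain A B where AB: "closed A" "closed B" "theta_zeros \<subseteq> A \<union> B" "A \<inter> B \<inter> theta_zeros = {}"
    "A \<inter> theta_zeros \<noteq> {}" "B \<inter> theta_zeros \<noteq> {}"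
    unfolding connected_closed by blast
  then have sep: "theta_separation A B" by (simp add: theta_separation_def)
  \<comment> \<open>If the side opposite to \<open>branch 0\<close> met the zero set, it would reach
    small q, where every zero lies on a branch and hence on the side of
    \<open>branch 0\<close>.\<close>
  have no: False if sep: "theta_separation A B" and ne: "B \<inter> theta_zeros \<noteq> {}" and b0: "branch 0 \<subseteq> A" for A B
  proof -
    obtain q z where qz: "(q, z) \<in> B \<inter> theta_zeros" "norm q < 1/100"
      using separation_reaches_small_q[OF theta_separation_sym[OF sep] ne] by blast
    obtain j where "(q, z) \<in> branch j" using small_zero_in_branch[of q z] qz by blast
    then have "(q, z) \<in> A" using all_branches_same_side[OF sep b0] by blast
    then show False using qz sep by (auto simp: theta_separation_def)
  qed
  have "branch 0 \<subseteq> A \<or> branch 0 \<subseteq> B"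
    using theta_separation_connected[OF sep connected_branch, of 0] by (auto simp: branch_def)
  then show False
    using no[OF sep] no[OF theta_separation_sym[OF sep]] AB by blast
qed

theorem theorem1:
  shows "connected theta_zeros
    \<and> analytic_subset theta_zeros theta_domain
    \<and> (\<forall>q z. (q, z) \<in> theta_zeros \<and>
          (zorder (partial_theta q) z = 1 \<or> zorder (partial_theta q) z = 2)
        \<longrightarrow> smooth_at theta_zeros theta_domain (q, z))"
  using connected_theta_zeros analytic_subset_theta_zeros smooth_at_theta_zeros by blast

end
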